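(* Let $A\supset P$ be an inclusion of unital $C^*$-algebras with the Rohlin property. If $A$ has real rank zero, then $P$ has real rank zero.
   Context: A unital $C^*$-algebra $A$ has real rank zero if the set of invertible self-adjoint elements of $A$ is dense in the set of self-adjoint elements of $A$. Inclusions of unital $C^*$-algebras have a common unit. For a conditional expectation $E:A\to P$, a quasi-basis is a finite set $\{(u_i,v_i)\}_{i=1}^n\subset A\times A$ with $a=\sum_i u_iE(v_ia)=\sum_i E(au_i)v_i$ for all $a\in A$. If one exists, $E$ has a finite index and $\mathrm{Index}\,E=\sum_i u_iv_i$ (independent of the choice; a positive central invertible element of $A$). Put $A^\infty=\ell^\infty(\mathbb{N},A)/c_0(A)$, $A$ being identified with the classes of constant sequences, and $A_\infty=A^\infty\cap A'$; $P^\infty$ is regarded as a subalgebra of $A^\infty$, and $E^\infty:A^\infty\to P^\infty$ is the termwise induced conditional expectation. A conditional expectation $E:A\to P$ with a finite index has the Rohlin property if there is a projection $e\in A_\infty$ with $E^\infty(e)=(\mathrm{Index}\,E)^{-1}\cdot1$ and such that the map $A\ni x\mapsto xe$ is injective. An inclusion $A\supset P$ has the Rohlin property if there is a conditional expectation $E:A\to P$ with a finite index having the Rohlin property. *)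

theory Defs
  imports "HOL-Analysis.Analysis"
begin

section \<open>Unital C*-algebras\<close>

class star =
  fixes star :: "'a \<Rightarrow> 'a"

text \<open>
  Unital C*-algebras over the complex numbers. The class \<open>real_normed_algebra_1\<close> supplies
  \<open>norm 1 = 1\<close>, so the unit is nonzero.
\<close>

class cstar_algebra = banach + real_normed_algebra_1 + star +
  fixes scaleC :: "complex \<Rightarrow> 'a \<Rightarrow> 'a"
  assumes scaleC_add_right: "scaleC a (x + y) = scaleC a x + scaleC a y"
    and scaleC_add_left: "scaleC (a + b) x = scaleC a x + scaleC b x"
    and scaleC_scaleC: "scaleC a (scaleC b x) = scaleC (a * b) x"
    and scaleC_of_real: "scaleC (complex_of_real r) x = r *\<^sub>R x"
    and scaleC_mult_left: "scaleC a x * y = scaleC a (x * y)"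
    and scaleC_mult_right: "x * scaleC a y = scaleC a (x * y)"
    and norm_scaleC: "norm (scaleC a x) = cmod a * norm x"
    and star_star: "star (star x) = x"
    and star_add: "star (x + y) = star x + star y"
    and star_mult: "star (x * y) = star y * star x"
    and star_scaleC: "star (scaleC a x) = scaleC (cnj a) (star x)"
    and norm_star_mult_self: "norm (star x * x) = (norm x)\<^sup>2"

instantiation complex :: cstar_algebra
begin

definition star_complex :: "complex \<Rightarrow> complex"
  where "star_complex = cnj"

definition scaleC_complex :: "complex \<Rightarrow> complex \<Rightarrow> complex"
  where "scaleC_complex = (*)"

instance
  by standard
    (auto simp: star_complex_def scaleC_complex_def algebra_simps norm_mult
      power2_eq_square scaleR_conv_of_real)

end

definition cstar_subalgebra :: "'a::cstar_algebra set \<Rightarrow> bool"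
  where "cstar_subalgebra P \<longleftrightarrow>
    1 \<in> P \<and> closed P \<and>
    (\<forall>x\<in>P. \<forall>y\<in>P. x + y \<in> P \<and> x * y \<in> P) \<and>
    (\<forall>c. \<forall>x\<in>P. scaleC c x \<in> P) \<and>
    (\<forall>x\<in>P. star x \<in> P)"

definition selfadjoint :: "'a::star \<Rightarrow> bool"
  where "selfadjoint x \<longleftrightarrow> star x = x"

definition projection :: "'a::{star,times} \<Rightarrow> bool"
  where "projection e \<longleftrightarrow> selfadjoint e \<and> e * e = e"

text \<open>Invertibility and positivity are relative to a subalgebra \<open>P\<close>.\<close>

definition invertible_in :: "'a::monoid_mult set \<Rightarrow> 'a \<Rightarrow> bool"
  where "invertible_in P x \<longleftrightarrow> x \<in> P \<and> (\<exists>y\<in>P. x * y = 1 \<and> y * x = 1)"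

definition positive_in :: "'a::cstar_algebra set \<Rightarrow> 'a \<Rightarrow> bool"
  where "positive_in P x \<longleftrightarrow> (\<exists>b\<in>P. x = star b * b)"

definition real_rank_zero :: "'a::cstar_algebra set \<Rightarrow> bool"
  where "real_rank_zero P \<longleftrightarrow>
    {x \<in> P. selfadjoint x} \<subseteq> closure {x \<in> P. selfadjoint x \<and> invertible_in P x}"


section \<open>Conditional expectations of finite index\<close>

text \<open>
  A conditional expectation is a positive, contractive \<open>P\<close>-bimodule projection onto \<open>P\<close>.
  (By Tomiyama's theorem these requirements are partly redundant, and complete positivity is
  automatic.)
\<close>

definition conditional_expectation :: "('a::cstar_algebra \<Rightarrow> 'a) \<Rightarrow> 'a set \<Rightarrow> bool"
  where "conditional_expectation E P \<longleftrightarrow>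
    (\<forall>x. E x \<in> P) \<and>
    (\<forall>x\<in>P. E x = x) \<and>
    (\<forall>x y. E (x + y) = E x + E y) \<and>
    (\<forall>c x. E (scaleC c x) = scaleC c (E x)) \<and>
    (\<forall>x. \<forall>p\<in>P. E (p * x) = p * E x \<and> E (x * p) = E x * p) \<and>
    (\<forall>x. positive_in UNIV x \<longrightarrow> positive_in P (E x)) \<and>
    (\<forall>x. norm (E x) \<le> norm x)"

definition quasi_basis ::
  "('a::cstar_algebra \<Rightarrow> 'a) \<Rightarrow> nat \<Rightarrow> (nat \<Rightarrow> 'a) \<Rightarrow> (nat \<Rightarrow> 'a) \<Rightarrow> bool"
  where "quasi_basis E n u v \<longleftrightarrow>
    (\<forall>a. a = (\<Sum>i<n. u i * E (v i * a)) \<and> a = (\<Sum>i<n. E (a * u i) * v i))"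

definition finite_index :: "('a::cstar_algebra \<Rightarrow> 'a) \<Rightarrow> bool"
  where "finite_index E \<longleftrightarrow> (\<exists>n u v. quasi_basis E n u v)"

definition Index :: "('a::cstar_algebra \<Rightarrow> 'a) \<Rightarrow> 'a"
  where "Index E = (THE d. \<exists>n u v. quasi_basis E n u v \<and> d = (\<Sum>i<n. u i * v i))"

lemma quasi_basis_index_unique:
  assumes "quasi_basis E n u v" "quasi_basis E m s t"
  shows "(\<Sum>i<n. u i * v i) = (\<Sum>j<m. s j * t j)"
proof -
  have v: "v i = (\<Sum>j<m. E (v i * s j) * t j)" for i
    using assms(2) unfolding quasi_basis_def by blast
  have s: "s j = (\<Sum>i<n. u i * E (v i * s j))" for j
    using assms(1) unfolding quasi_basis_def by blast
  have "(\<Sum>i<n. u i * v i) = (\<Sum>i<n. u i * (\<Sum>j<m. E (v i * s j) * t j))"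
    by (subst v) (rule refl)
  also have "\<dots> = (\<Sum>j<m. (\<Sum>i<n. u i * E (v i * s j)) * t j)"
    unfolding sum_distrib_left sum_distrib_right by (subst sum.swap) (simp add: mult.assoc)
  also have "\<dots> = (\<Sum>j<m. s j * t j)"
    by (simp flip: s)
  finally show ?thesis .
qed

lemma Index_eq:
  assumes "quasi_basis E n u v"
  shows "Index E = (\<Sum>i<n. u i * v i)"
  unfolding Index_def using assms quasi_basis_index_unique by (intro the_equality) blast+


section \<open>The sequence algebra \<open>A\<^sup>\<infinity>\<close>\<close>

text \<open>
  The quotient of the bounded sequences by the null sequences, as a unital *-ring. The
  relation is a partial equivalence whose domain consists of the bounded sequences.
\<close>

definition seq_rel :: "(nat \<Rightarrow> 'a::real_normed_vector) \<Rightarrow> (nat \<Rightarrow> 'a) \<Rightarrow> bool"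
  where "seq_rel x y \<longleftrightarrow> Bseq x \<and> Bseq y \<and> (\<lambda>n. x n - y n) \<longlonglongrightarrow> 0"

lemma part_equivp_seq_rel: "part_equivp seq_rel"
proof (rule part_equivpI)
  show "\<exists>x::nat \<Rightarrow> 'a. seq_rel x x"
    by (rule exI[of _ "\<lambda>_. 0"]) (simp add: seq_rel_def)
  show "symp (seq_rel :: (nat \<Rightarrow> 'a) \<Rightarrow> _)"
  proof (rule sympI)
    fix x y :: "nat \<Rightarrow> 'a"
    assume "seq_rel x y"
    then show "seq_rel y x"
      using tendsto_minus[of "\<lambda>n. x n - y n" 0 sequentially] by (simp add: seq_rel_def)
  qed
  show "transp (seq_rel :: (nat \<Rightarrow> 'a) \<Rightarrow> _)"
  proof (rule transpI)
    fix x y z :: "nat \<Rightarrow> 'a"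
    assume "seq_rel x y" "seq_rel y z"
    then show "seq_rel x z"
      using tendsto_add[of "\<lambda>n. x n - y n" 0 sequentially "\<lambda>n. y n - z n" 0]
      by (simp add: seq_rel_def)
  qed
qed

quotient_type (overloaded) 'a seq_alg = "nat \<Rightarrow> 'a::cstar_algebra" / partial: seq_rel
  by (rule part_equivp_seq_rel)

lemma Bseq_bound: "Bseq x \<longleftrightarrow> (\<exists>K. \<forall>n. norm (x n :: 'a::real_normed_vector) \<le> K)"
  by (meson BseqE BseqI')

lemma Bseq_plus:
  fixes x y :: "nat \<Rightarrow> 'a::real_normed_vector"
  assumes "Bseq x" "Bseq y"
  shows "Bseq (\<lambda>n. x n + y n)"
proof -
  obtain K L where "\<forall>n. norm (x n) \<le> K" "\<forall>n. norm (y n) \<le> L"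
    using assms unfolding Bseq_bound by blast
  then have "norm (x n + y n) \<le> K + L" for n
    by (meson add_mono norm_triangle_le)
  then show ?thesis unfolding Bseq_bound by blast
qed

lemma Bseq_times:
  fixes x y :: "nat \<Rightarrow> 'a::real_normed_algebra"
  assumes "Bseq x" "Bseq y"
  shows "Bseq (\<lambda>n. x n * y n)"
proof -
  obtain K L where KL: "\<forall>n. norm (x n) \<le> K" "\<forall>n. norm (y n) \<le> L"
    using assms unfolding Bseq_bound by blast
  then have "0 \<le> K" using norm_ge_zero order_trans by blast
  with KL have "norm (x n * y n) \<le> K * L" for n
    by (meson mult_mono norm_ge_zero norm_mult_ineq order_trans)
  then show ?thesis unfolding Bseq_bound by blast
qed

lemma null_mult_Bseq:
  fixes x y :: "nat \<Rightarrow> 'a::real_normed_algebra"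
  assumes "x \<longlonglongrightarrow> 0" "Bseq y"
  shows "(\<lambda>n. x n * y n) \<longlonglongrightarrow> 0" "(\<lambda>n. y n * x n) \<longlonglongrightarrow> 0"
  using bounded_bilinear.Zfun_prod_Bfun[OF bounded_bilinear_mult, of x sequentially y]
    bounded_bilinear.Bfun_prod_Zfun[OF bounded_bilinear_mult, of y sequentially x] assms
  by (simp_all add: tendsto_Zfun_iff)

lemma norm_star: "norm (star x) = norm (x :: 'a::cstar_algebra)"
proof -
  have le: "norm y \<le> norm (star y)" for y :: 'a
  proof (cases "y = 0")
    case False
    have "norm y * norm y \<le> norm (star y) * norm y"
      using norm_mult_ineq[of "star y" y] norm_star_mult_self[of y]
      by (simp add: power2_eq_square)
    with False show ?thesis by simp
  qed simp
  show ?thesis using le[of x] le[of "star x"] by (simp add: star_star)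
qed

lemma star_diff: "star (x - y) = star x - star (y :: 'a::cstar_algebra)"
  using star_add[of "x - y" y] by simp

instantiation seq_alg :: (cstar_algebra) ring_1
begin

lift_definition zero_seq_alg :: "'a seq_alg" is "\<lambda>_. 0"
  by (simp add: seq_rel_def)

lift_definition one_seq_alg :: "'a seq_alg" is "\<lambda>_. 1"
  by (simp add: seq_rel_def)

lift_definition plus_seq_alg :: "'a seq_alg \<Rightarrow> 'a seq_alg \<Rightarrow> 'a seq_alg"
  is "\<lambda>x y n. x n + y n"
proof -
  fix x x' y y' :: "nat \<Rightarrow> 'a"
  assume "seq_rel x x'" "seq_rel y y'"
  then show "seq_rel (\<lambda>n. x n + y n) (\<lambda>n. x' n + y' n)"
    using tendsto_add[of "\<lambda>n. x n - x' n" 0 sequentially "\<lambda>n. y n - y' n" 0]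
    by (simp add: seq_rel_def Bseq_plus algebra_simps)
qed

lift_definition uminus_seq_alg :: "'a seq_alg \<Rightarrow> 'a seq_alg" is "\<lambda>x n. - x n"
proof -
  fix x x' :: "nat \<Rightarrow> 'a"
  assume "seq_rel x x'"
  then show "seq_rel (\<lambda>n. - x n) (\<lambda>n. - x' n)"
    using tendsto_minus[of "\<lambda>n. x n - x' n" 0 sequentially]
    by (simp add: seq_rel_def Bseq_bound)
qed

definition minus_seq_alg :: "'a seq_alg \<Rightarrow> 'a seq_alg \<Rightarrow> 'a seq_alg"
  where "minus_seq_alg x y = x + - y"

lift_definition times_seq_alg :: "'a seq_alg \<Rightarrow> 'a seq_alg \<Rightarrow> 'a seq_alg"
  is "\<lambda>x y n. x n * y n"
proof -
  fix x x' y y' :: "nat \<Rightarrow> 'a"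
  assume *: "seq_rel x x'" "seq_rel y y'"
  have "(\<lambda>n. (x n - x' n) * y n + x' n * (y n - y' n)) \<longlonglongrightarrow> 0 + 0"
    using * by (intro tendsto_add null_mult_Bseq) (auto simp: seq_rel_def)
  with * show "seq_rel (\<lambda>n. x n * y n) (\<lambda>n. x' n * y' n)"
    by (simp add: seq_rel_def Bseq_times algebra_simps)
qed

instance
proof
  fix a b c :: "'a seq_alg"
  show "a + b + c = a + (b + c)"
    by transfer (auto simp: seq_rel_def add.assoc intro!: Bseq_plus)
  show "a + b = b + a"
    by transfer (auto simp: seq_rel_def add.commute intro!: Bseq_plus)
  show "0 + a = a"
    by transfer (auto simp: seq_rel_def)
  show "- a + a = 0"
    by transfer (auto simp: seq_rel_def)
  show "a - b = a + - b"
    by (simp add: minus_seq_alg_def)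
  show "a * b * c = a * (b * c)"
    by transfer (auto simp: seq_rel_def mult.assoc intro!: Bseq_times)
  show "1 * a = a" "a * 1 = a"
    by (transfer; auto simp: seq_rel_def)+
  show "(a + b) * c = a * c + b * c" "a * (b + c) = a * b + a * c"
    by (transfer; auto simp: seq_rel_def algebra_simps intro!: Bseq_plus Bseq_times)+
  show "(0 :: 'a seq_alg) \<noteq> 1"
    by transfer (simp add: seq_rel_def LIMSEQ_const_iff)
qed

end

instantiation seq_alg :: (cstar_algebra) star
begin

lift_definition star_seq_alg :: "'a seq_alg \<Rightarrow> 'a seq_alg" is "\<lambda>x n. star (x n)"
proof -
  fix x x' :: "nat \<Rightarrow> 'a"
  assume *: "seq_rel x x'"
  then have "(\<lambda>n. norm (star (x n - x' n))) \<longlonglongrightarrow> 0"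
    by (simp add: seq_rel_def norm_star tendsto_norm_zero)
  then have "(\<lambda>n. star (x n) - star (x' n)) \<longlonglongrightarrow> 0"
    by (simp add: star_diff tendsto_norm_zero_iff)
  with * show "seq_rel (\<lambda>n. star (x n)) (\<lambda>n. star (x' n))"
    by (simp add: seq_rel_def Bseq_bound norm_star)
qed

instance ..

end

lift_definition const_seq :: "'a::cstar_algebra \<Rightarrow> 'a seq_alg" is "\<lambda>a _. a"
  by (simp add: seq_rel_def)

text \<open>\<open>A\<^sub>\<infinity>\<close>, the relative commutant of the constant sequences.\<close>

definition central_seq_alg :: "'a::cstar_algebra seq_alg set"
  where "central_seq_alg = {x. \<forall>a. const_seq a * x = x * const_seq a}"

text \<open>
  The termwise extension of \<open>E\<close>, computed on a chosen representing sequence; by the lemma below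
  the result does not depend on this choice when \<open>E\<close> is a conditional expectation.
\<close>

definition E_inf :: "('a::cstar_algebra \<Rightarrow> 'a) \<Rightarrow> 'a seq_alg \<Rightarrow> 'a seq_alg"
  where "E_inf E X = abs_seq_alg (\<lambda>n. E (rep_seq_alg X n))"

lemma E_inf_abs:
  assumes E: "conditional_expectation E P" and x: "Bseq x"
  shows "E_inf E (abs_seq_alg x) = abs_seq_alg (\<lambda>n. E (x n))"
proof -
  have add: "E (a + b) = E a + E b" and norm: "norm (E a) \<le> norm a" for a b
    using E unfolding conditional_expectation_def by blast+
  have diff: "E (a - b) = E a - E b" for a b
    using add[of "a - b" b] by simp
  define y where "y = rep_seq_alg (abs_seq_alg x)"
  have "seq_rel x x"
    using x by (simp add: seq_rel_def)
  then have yx: "seq_rel y x"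
    unfolding y_def by (rule Quotient3_seq_alg[THEN rep_abs_rsp_left])
  have "Bseq (\<lambda>n. E (z n))" if "Bseq z" for z :: "nat \<Rightarrow> 'a"
    using that norm unfolding Bseq_bound by (meson order_trans)
  moreover have "(\<lambda>n. E (y n) - E (x n)) \<longlonglongrightarrow> 0"
  proof (rule Lim_null_comparison)
    show "\<forall>\<^sub>F n in sequentially. norm (E (y n) - E (x n)) \<le> norm (y n - x n)"
      using norm by (simp flip: diff)
    show "(\<lambda>n. norm (y n - x n)) \<longlonglongrightarrow> 0"
      using yx by (simp add: seq_rel_def tendsto_norm_zero)
  qed
  ultimately have "seq_rel (\<lambda>n. E (y n)) (\<lambda>n. E (x n))"
    using yx by (simp add: seq_rel_def)
  then show ?thesis
    unfolding E_inf_def y_def by (rule Quotient3_seq_alg[THEN Quotient3_rel_abs])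
qed


section \<open>The Rohlin property\<close>

text \<open>The element \<open>w\<close> below is the inverse of \<open>Index E\<close>.\<close>

definition rohlin_expectation :: "('a::cstar_algebra \<Rightarrow> 'a) \<Rightarrow> bool"
  where "rohlin_expectation E \<longleftrightarrow>
    (\<exists>e\<in>central_seq_alg. projection e \<and>
      (\<exists>w. w * Index E = 1 \<and> Index E * w = 1 \<and> E_inf E e = const_seq w) \<and>
      inj (\<lambda>x. const_seq x * e))"

definition rohlin_inclusion :: "'a::cstar_algebra set \<Rightarrow> bool"
  where "rohlin_inclusion P \<longleftrightarrow>
    (\<exists>E. conditional_expectation E P \<and> finite_index E \<and> rohlin_expectation E)"

end

theory Submission
  imports Defs
begin

text \<open>
  Let \<open>d\<close> be the index and \<open>e\<close> the Rohlin projection. Since \<open>E\<^sup>\<infinity>(e) = d\<^sup>-\<^sup>1\<close>, the map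
  \<open>T x = e x - d e E\<^sup>\<infinity>(e x)\<close> is a projection on the Hilbert \<open>P\<^sup>\<infinity>\<close>-module \<open>A\<^sup>\<infinity>\<close> with its
  \<open>E\<^sup>\<infinity>\<close>-valued inner product. Its trace with respect to a quasi-basis is \<open>e d - d e e = 0\<close>.
  Positivity forces \<open>T = 0\<close>, that is
  \<open>e x = d e E\<^sup>\<infinity>(e x)\<close> for \<open>x \<in> A\<close>. Since \<open>e\<close> commutes with \<open>A\<close>, it follows that
  \<open>x \<mapsto> d E\<^sup>\<infinity>(e x)\<close> is a unital *-homomorphism from \<open>A\<close> to \<open>P\<^sup>\<infinity>\<close> that fixes \<open>P\<close>. It sends a
  self-adjoint invertible element of \<open>A\<close> near \<open>p \<in> P\<close> to one of \<open>P\<^sup>\<infinity>\<close> near \<open>p\<close>, and the late terms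
  of a self-adjoint representing sequence are invertible in \<open>P\<close>.
\<close>

section \<open>Positivity in C*-algebras\<close>

lemma scaleC_minus_left: "scaleC (- c) x = - scaleC c (x :: 'a::cstar_algebra)"
proof -
  have "scaleC (- c) x + scaleC c x = 0"
    using scaleC_of_real[of 0 x] by (simp flip: scaleC_add_left)
  then show ?thesis by (simp add: eq_neg_iff_add_eq_0)
qed

lemma scaleC_minus_right: "scaleC c (- x) = - scaleC c (x :: 'a::cstar_algebra)"
proof -
  have "scaleC c (0 :: 'a) = 0"
    using scaleC_add_right[of c "0 :: 'a" 0] by simp
  then show ?thesis
    by (simp add: eq_neg_iff_add_eq_0 flip: scaleC_add_right)
qed

lemma scaleC_one [simp]: "scaleC 1 x = (x :: 'a::cstar_algebra)"
  using scaleC_of_real[of 1 x] by simp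

lemma scaleC_i_mult [simp]:
  fixes x y :: "'a::cstar_algebra"
  shows "scaleC \<i> x * scaleC \<i> y = - (x * y)"
  by (simp add: scaleC_mult_left scaleC_mult_right scaleC_scaleC scaleC_minus_left)

lemma star_scaleR: "star (r *\<^sub>R x) = r *\<^sub>R star (x :: 'a::cstar_algebra)"
  by (metis complex_cnj_complex_of_real scaleC_of_real star_scaleC)

lemma bounded_linear_star: "bounded_linear (star :: 'a::cstar_algebra \<Rightarrow> 'a)"
  by (rule bounded_linear_intro[where K = 1]) (simp_all add: star_add star_scaleR norm_star)

lemmas tendsto_star = bounded_linear.tendsto[OF bounded_linear_star]

lemma star_zero [simp]: "star (0 :: 'a::cstar_algebra) = 0"
  by (simp add: linear_simps bounded_linear_star)

lemma star_one [simp]: "star (1 :: 'a::cstar_algebra) = 1"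
  by (metis mult.left_neutral mult.right_neutral star_mult star_star)

lemma star_sum: "star (sum f I) = (\<Sum>i\<in>I. star (f i :: 'a::cstar_algebra))"
  by (induction I rule: infinite_finite_induct) (simp_all add: star_add)

lemma star_power: "star (x ^ n) = star (x :: 'a::cstar_algebra) ^ n"
  by (induction n) (simp_all add: star_mult power_commutes)

lemma selfadjoint_zero [simp]: "selfadjoint (0 :: 'a::cstar_algebra)"
  and selfadjoint_one [simp]: "selfadjoint (1 :: 'a::cstar_algebra)"
  by (simp_all add: selfadjoint_def)

lemma selfadjoint_add: "selfadjoint x \<Longrightarrow> selfadjoint y \<Longrightarrow> selfadjoint (x + y :: 'a::cstar_algebra)"
  and selfadjoint_diff: "selfadjoint x \<Longrightarrow> selfadjoint y \<Longrightarrow> selfadjoint (x - y :: 'a::cstar_algebra)"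
  and selfadjoint_scaleR: "selfadjoint x \<Longrightarrow> selfadjoint (r *\<^sub>R x :: 'a::cstar_algebra)"
  by (simp_all add: selfadjoint_def star_add star_diff star_scaleR)

lemma selfadjoint_mult:
  "selfadjoint x \<Longrightarrow> selfadjoint y \<Longrightarrow> x * y = y * x \<Longrightarrow> selfadjoint (x * y :: 'a::cstar_algebra)"
  by (simp add: selfadjoint_def star_mult)

lemma selfadjoint_star_mult_self: "selfadjoint (star x * x :: 'a::cstar_algebra)"
  by (simp add: selfadjoint_def star_mult star_star)

lemma norm_selfadjoint_square:
  "selfadjoint x \<Longrightarrow> norm (x * x :: 'a::cstar_algebra) = (norm x)\<^sup>2"
  using norm_star_mult_self[of x] by (simp add: selfadjoint_def)

lemma closed_selfadjoint: "closed {x :: 'a::cstar_algebra. selfadjoint x}"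
  unfolding selfadjoint_def
  by (rule closed_Collect_eq[OF linear_continuous_on[OF bounded_linear_star] continuous_on_id])

text \<open>For self-adjoint \<open>a\<close>, \<open>norm (t - a) \<le> t\<close> says that the spectrum of \<open>a\<close> lies in \<open>[0, 2t]\<close>.\<close>

definition nonneg :: "'a::cstar_algebra \<Rightarrow> bool"
  where "nonneg a \<longleftrightarrow> selfadjoint a \<and> (\<exists>t. norm (t *\<^sub>R 1 - a) \<le> t)"

lemma nonneg_selfadjoint: "nonneg a \<Longrightarrow> selfadjoint a"
  by (simp add: nonneg_def)

text \<open>In terms of the witnesses, closure under sums is just the triangle inequality. For
  elements \<open>star x * x\<close> it would be far from obvious; these are shown to be
  \<open>nonneg\<close> only in \<open>nonneg_star_mult_self\<close>.\<close>

lemma nonneg_add: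
  assumes "nonneg a" "nonneg b"
  shows "nonneg (a + b)"
proof -
  obtain s t where "norm (s *\<^sub>R 1 - a) \<le> s" "norm (t *\<^sub>R 1 - b) \<le> t"
    using assms by (auto simp: nonneg_def)
  then have "norm ((s + t) *\<^sub>R 1 - (a + b)) \<le> s + t"
    using norm_triangle_ineq[of "s *\<^sub>R 1 - a" "t *\<^sub>R 1 - b"] by (simp add: algebra_simps)
  with assms show ?thesis
    unfolding nonneg_def by (blast intro: selfadjoint_add)
qed

lemma nonneg_scaleR:
  assumes "nonneg a" "0 \<le> r"
  shows "nonneg (r *\<^sub>R a)"
proof -
  obtain t where t: "norm (t *\<^sub>R 1 - a) \<le> t"
    using assms by (auto simp: nonneg_def)
  have "(r * t) *\<^sub>R 1 - r *\<^sub>R a = r *\<^sub>R (t *\<^sub>R 1 - a)"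
    by (simp add: algebra_simps)
  then have "norm ((r * t) *\<^sub>R 1 - r *\<^sub>R a) \<le> r * t"
    using t assms(2) by (simp add: mult_left_mono)
  with assms show ?thesis
    unfolding nonneg_def by (blast intro: selfadjoint_scaleR)
qed

lemma nonneg_diff_of_norm_le:
  assumes "selfadjoint a" "norm a \<le> t"
  shows "nonneg (t *\<^sub>R 1 - a)"
  unfolding nonneg_def using assms
  by (auto intro!: selfadjoint_diff selfadjoint_scaleR exI[of _ t])

lemma nonneg_zero [simp]: "nonneg 0"
  by (auto simp: nonneg_def intro: exI[of _ 0])


subsection \<open>Square roots\<close>

text \<open>These are the coefficients of sqrt(1 - x) and of 1 / sqrt(1 - x). The second are
  Pochhammer symbols of 1/2 over factorials; absorption reduces the first to the second.\<close>

lemma alternating_gbinomial_half: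
  fixes k :: nat
  shows "k > 0 \<Longrightarrow> (-1) ^ k * (1/2 gchoose k) \<le> (0 :: real)"
    and "(-1) ^ k * (-1/2 gchoose k) \<ge> (0 :: real)"
proof -
  have neg: "(-1) ^ k * (-1/2 gchoose k) \<ge> (0 :: real)" for k
    unfolding gbinomial_pochhammer
    by (simp flip: power_mult_distrib add: pochhammer_nonneg)
  show "(-1) ^ k * (-1/2 gchoose k) \<ge> (0 :: real)" by (rule neg)
  assume "k > 0"
  then obtain m where k: "k = Suc m" by (cases k) auto
  have "(1/2 gchoose Suc m) = (1/2) / real (Suc m) * (-1/2 gchoose m)"
    using gbinomial_absorption'[of "Suc m" "1/2 :: real"] by simp
  then have "(-1) ^ k * (1/2 gchoose k) = - ((1/2) / real (Suc m)) * ((-1) ^ m * (-1/2 gchoose m) :: real)"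
    by (simp add: k)
  also have "\<dots> \<le> 0"
    using neg[of m] by (intro mult_nonpos_nonneg) auto
  finally show "(-1) ^ k * (1/2 gchoose k) \<le> (0 :: real)" .
qed

text \<open>The Taylor coefficients of sqrt(1 - x) at 0.\<close>

definition sqrt_coeff :: "nat \<Rightarrow> real"
  where "sqrt_coeff k = (-1) ^ k * (1/2 gchoose k)"

lemma sqrt_coeff_0 [simp]: "sqrt_coeff 0 = 1"
  by (simp add: sqrt_coeff_def)

text \<open>All coefficients after the first are nonpositive, so the sum is 1 minus a partial sum of
  the series. That partial sum is a coefficient of 1 / sqrt(1 - x), hence nonnegative.\<close>

lemma sum_abs_sqrt_coeff: "(\<Sum>k<n. \<bar>sqrt_coeff (Suc k)\<bar>) \<le> 1"
proof -
  have "(\<Sum>k<n. \<bar>sqrt_coeff (Suc k)\<bar>) = - (\<Sum>k<n. sqrt_coeff (Suc k))"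
    using alternating_gbinomial_half(1)
    by (simp add: sqrt_coeff_def abs_of_nonpos flip: sum_negf del: power_Suc)
  also have "\<dots> = 1 - (\<Sum>k\<le>n. sqrt_coeff k)"
    by (simp add: sum.atMost_shift)
  also have "(\<Sum>k\<le>n. sqrt_coeff k) = (-1) ^ n * (-1/2 gchoose n)"
    using gbinomial_sum_lower_neg[of "1/2 :: real" n] by (simp add: sqrt_coeff_def mult.commute)
  finally show ?thesis
    using alternating_gbinomial_half(2)[of n] by simp
qed

lemma summable_abs_sqrt_coeff: "summable (\<lambda>k. \<bar>sqrt_coeff k\<bar>)"
  using bounded_imp_summable[OF _ sum_abs_sqrt_coeff[of "Suc _", unfolded lessThan_Suc_atMost]]
  by (subst summable_Suc_iff[symmetric]) auto

text \<open>The square of sqrt(1 - x) is 1 - x, coefficient by coefficient; this is Vandermonde's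
  identity with 1/2 + 1/2 = 1.\<close>

lemma sqrt_coeff_convolution:
  "(\<Sum>i\<le>n. sqrt_coeff i * sqrt_coeff (n - i)) = (if n = 0 then 1 else if n = 1 then -1 else 0)"
proof -
  have "(\<Sum>i\<le>n. sqrt_coeff i * sqrt_coeff (n - i)) =
      (-1) ^ n * (\<Sum>i\<le>n. (1/2 gchoose i) * (1/2 gchoose (n - i)))"
    unfolding sum_distrib_left
    by (intro sum.cong) (auto simp: sqrt_coeff_def simp flip: power_add)
  also have "(\<Sum>i\<le>n. (1/2 gchoose i) * (1/2 gchoose (n - i))) = (1 gchoose n :: real)"
    using gbinomial_Vandermonde[of "1/2 :: real" "1/2" n] by (simp add: atMost_atLeast0)
  also have "(1 gchoose n :: real) = of_nat (1 choose n)"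
    by (simp add: binomial_gbinomial)
  finally show ?thesis
    by (cases n; cases "n - 1") auto
qed

text \<open>The Taylor series converges absolutely up to norm 1, since its coefficients are
  absolutely summable. The commutation clause records that \<open>s\<close> is a limit of
  polynomials in \<open>h\<close>; it takes the place of functional calculus below.\<close>

lemma sqrt_one_minus:
  fixes h :: "'a::cstar_algebra"
  assumes h: "selfadjoint h" "norm h \<le> 1"
  obtains s where "nonneg s" "s * s = 1 - h" "\<And>y. y * h = h * y \<Longrightarrow> y * s = s * y"
proof -
  define f where "f k = sqrt_coeff k *\<^sub>R h ^ k" for k
  have norm_f: "norm (f k) \<le> \<bar>sqrt_coeff k\<bar>" for k
    using norm_power_ineq[of h k] power_le_one[of "norm h" k] h(2)
    by (simp add: f_def mult_left_le)
  have sum_norm: "summable (\<lambda>k. norm (f k))"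
    by (rule summable_comparison_test'[OF summable_abs_sqrt_coeff]) (simp add: norm_f)
  then have sf: "summable f" by (rule summable_norm_cancel)
  define s where "s = suminf f"
  have "s * s = (\<Sum>n. \<Sum>i\<le>n. f i * f (n - i))"
    unfolding s_def by (rule Cauchy_product[OF sum_norm sum_norm])
  also have "(\<lambda>n. \<Sum>i\<le>n. f i * f (n - i)) = (\<lambda>n. if n \<in> {0, 1} then (if n = 0 then 1 else - h) else 0)"
  proof
    fix n
    have "(\<Sum>i\<le>n. f i * f (n - i)) = (\<Sum>i\<le>n. sqrt_coeff i * sqrt_coeff (n - i)) *\<^sub>R h ^ n"
      unfolding scaleR_left.sum by (intro sum.cong) (auto simp: f_def simp flip: power_add)
    then show "(\<Sum>i\<le>n. f i * f (n - i)) = (if n \<in> {0, 1} then (if n = 0 then 1 else - h) else 0)"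
      by (auto simp: sqrt_coeff_convolution)
  qed
  also have "(\<Sum>n. if n \<in> {0, 1} then (if n = 0 then 1 else - h) else 0) = 1 - h"
    using sums_If_finite_set[of "{0, 1 :: nat}" "\<lambda>n. if n = 0 then 1 else - h"]
    by (simp add: sums_iff)
  finally have "s * s = 1 - h" .
  moreover have "y * s = s * y" if y: "y * h = h * y" for y
  proof -
    have "y * h ^ k = h ^ k * y" for k
      by (rule power_commuting_commutes[OF y[symmetric], symmetric])
    then show ?thesis
      unfolding s_def by (simp add: suminf_mult suminf_mult2 sf f_def flip: suminf_mult[OF sf] suminf_mult2[OF sf])
  qed
  moreover have "nonneg s"
  proof -
    have "star (f k) = f k" for k
      using h(1) by (simp add: f_def star_scaleR star_power selfadjoint_def)
    then have "star s = s"
      unfolding s_def bounded_linear.suminf[OF bounded_linear_star sf] by simp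
    \<comment> \<open>The head of the series is 1, and the remaining coefficients have absolute sum
      at most 1, so \<open>t = 1\<close> witnesses \<open>nonneg s\<close>.\<close>
    moreover have "norm (1 *\<^sub>R 1 - s) \<le> 1"
    proof -
      have "1 *\<^sub>R 1 - s = - (\<Sum>k. f (Suc k))"
        unfolding s_def using suminf_split_head[OF sf] by (simp add: f_def)
      also have "norm \<dots> \<le> (\<Sum>k. norm (f (Suc k)))"
        using summable_norm[of "\<lambda>k. f (Suc k)"] sum_norm summable_Suc_iff[of "\<lambda>k. norm (f k)"] by simp
      also have "\<dots> \<le> 1"
      proof (rule suminf_le_const)
        show "summable (\<lambda>k. norm (f (Suc k)))"
          using sum_norm summable_Suc_iff[of "\<lambda>k. norm (f k)"] by simp
        show "(\<Sum>k<n. norm (f (Suc k))) \<le> 1" for n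
          by (rule order_trans[OF sum_mono sum_abs_sqrt_coeff]) (rule norm_f)
      qed
      finally show ?thesis .
    qed
    ultimately show ?thesis
      unfolding nonneg_def selfadjoint_def by blast
  qed
  ultimately show thesis by (intro that)
qed

text \<open>For a witness \<open>t > 0\<close>, write \<open>a = t (1 - h)\<close>; the witness
  condition is exactly \<open>norm h \<le> 1\<close>. A witness 0 forces
  \<open>a = 0\<close>.\<close>

lemma nonneg_sqrt:
  fixes a :: "'a::cstar_algebra"
  assumes "nonneg a"
  obtains s where "nonneg s" "s * s = a" "\<And>y. y * a = a * y \<Longrightarrow> y * s = s * y"
proof -
  obtain t where t: "norm (t *\<^sub>R 1 - a) \<le> t" and a: "selfadjoint a"
    using assms by (auto simp: nonneg_def)
  then consider "t = 0" | "t > 0"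
    by (metis norm_ge_zero order_trans order_le_less)
  then show thesis
  proof cases
    case 1
    with t show thesis by (intro that[of 0]) auto
  next
    case 2
    define h where "h = 1 - (1 / t) *\<^sub>R a"
    have "h = (1 / t) *\<^sub>R (t *\<^sub>R 1 - a)"
      using 2 by (simp add: h_def algebra_simps)
    then have "norm h \<le> 1"
      using t 2 by (simp add: divide_simps)
    moreover have h: "selfadjoint h"
      using a by (simp add: h_def selfadjoint_diff selfadjoint_scaleR)
    ultimately obtain s where s: "nonneg s" "s * s = 1 - h" "\<And>y. y * h = h * y \<Longrightarrow> y * s = s * y"
      using sqrt_one_minus[OF h] by blast
    show thesis
    proof (rule that[of "sqrt t *\<^sub>R s"])
      show "nonneg (sqrt t *\<^sub>R s)"
        using 2 s(1) by (intro nonneg_scaleR) auto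
      show "sqrt t *\<^sub>R s * sqrt t *\<^sub>R s = a"
        using 2 s(2) by (simp add: h_def)
      show "y * sqrt t *\<^sub>R s = sqrt t *\<^sub>R s * y" if "y * a = a * y" for y
      proof -
        have "y * h = h * y"
          using that by (simp add: h_def right_diff_distrib left_diff_distrib)
        then show ?thesis by (simp add: s(3))
      qed
    qed
  qed
qed

text \<open>The element \<open>u = r + i s\<close> is normal with \<open>star u * u = t\<close>, so
  its norm is the square root of \<open>t\<close>, and \<open>r\<close> is its real part.\<close>

lemma norm_le_of_sum_squares:
  fixes r s :: "'a::cstar_algebra"
  assumes "selfadjoint r" "selfadjoint s" "r * s = s * r" "r * r + s * s = t *\<^sub>R 1" "0 \<le> t"
  shows "(norm r)\<^sup>2 \<le> t"
proof -
  define u where "u = r + scaleC \<i> s"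
  have su: "star u = r - scaleC \<i> s"
    using assms by (simp add: u_def star_add star_scaleC selfadjoint_def scaleC_minus_left)
  have "star u * u = r * r + s * s"
    using assms(3) unfolding su by (simp add: u_def algebra_simps) (simp add: scaleC_mult_left scaleC_mult_right)
  with assms(4,5) have u: "(norm u)\<^sup>2 = t"
    using norm_star_mult_self[of u] by simp
  have "2 *\<^sub>R r = u + star u"
    by (simp add: su) (simp add: u_def scaleR_2)
  then have "2 * norm r \<le> 2 * norm u"
    using norm_triangle_ineq[of u "star u"] norm_scaleR[of 2 r] by (simp add: norm_star)
  then show ?thesis
    using u by (metis mult_le_cancel_left_pos norm_ge_zero power_mono zero_less_numeral)
qed

text \<open>Scale to norm 1 and put \<open>c = sqrt (1 - b * b)\<close>. Then
  \<open>b * b + c * c = 1\<close> bounds the norm of \<open>c * c = 1 - b * b\<close> by 1, which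
  is the witness condition for \<open>t = 1\<close>.\<close>

lemma nonneg_square:
  fixes s :: "'a::cstar_algebra"
  assumes "selfadjoint s"
  shows "nonneg (s * s)"
proof (cases "s = 0")
  case False
  define b where "b = (1 / norm s) *\<^sub>R s"
  have b: "selfadjoint b" "norm b = 1" "s * s = (norm s)\<^sup>2 *\<^sub>R (b * b)"
    using assms False by (auto simp: b_def selfadjoint_scaleR power2_eq_square)
  obtain c where c: "nonneg c" "c * c = 1 - b * b" "\<And>y. y * (b * b) = (b * b) * y \<Longrightarrow> y * c = c * y"
    using sqrt_one_minus[of "b * b"] b norm_selfadjoint_square[of b]
    by (metis order_refl power_one selfadjoint_mult)
  have "(norm c)\<^sup>2 \<le> 1"
    using c(1,2) c(3)[of b] b(1)
    by (intro norm_le_of_sum_squares[of c b]) (simp_all add: nonneg_selfadjoint mult.assoc)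
  then have "norm (1 *\<^sub>R 1 - b * b) \<le> 1"
    using norm_selfadjoint_square[of c] c(1,2) by (simp add: nonneg_selfadjoint)
  moreover have "selfadjoint (b * b)"
    using b by (simp add: selfadjoint_mult)
  ultimately have "nonneg (b * b)"
    unfolding nonneg_def by blast
  then show ?thesis
    unfolding b(3) by (rule nonneg_scaleR) simp
qed simp

lemma norm_le_of_nonneg:
  fixes z :: "'a::cstar_algebra"
  assumes "nonneg z" "nonneg (t *\<^sub>R 1 - z)"
  shows "norm z \<le> t"
proof -
  \<comment> \<open>The sign of \<open>t\<close> is extracted from the hypotheses: they add up to
    \<open>nonneg (t 1)\<close>, whose witness \<open>\<tau>\<close> satisfies
    \<open>|\<tau> - t| \<le> \<tau>\<close>.\<close>
  have "nonneg (t *\<^sub>R (1 :: 'a))"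
    using nonneg_add[OF assms] by simp
  then obtain \<tau> where "norm (\<tau> *\<^sub>R 1 - t *\<^sub>R (1 :: 'a)) \<le> \<tau>"
    by (auto simp: nonneg_def)
  then have t: "0 \<le> t"
    by (simp flip: scaleR_left_diff_distrib)
  obtain r where r: "nonneg r" "r * r = z" "\<And>y. y * z = z * y \<Longrightarrow> y * r = r * y"
    using nonneg_sqrt[OF assms(1)] by blast
  obtain s where s: "nonneg s" "s * s = t *\<^sub>R 1 - z"
      "\<And>y. y * (t *\<^sub>R 1 - z) = (t *\<^sub>R 1 - z) * y \<Longrightarrow> y * s = s * y"
    using nonneg_sqrt[OF assms(2)] by blast
  have "r * z = z * r" using r(2) by (metis mult.assoc)
  then have "r * s = s * r" by (intro s(3)) (simp add: algebra_simps)
  then have "(norm r)\<^sup>2 \<le> t"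
    using r(1,2) s(1,2) t by (intro norm_le_of_sum_squares[of r s]) (simp_all add: nonneg_selfadjoint)
  then show ?thesis
    using r(1,2) norm_selfadjoint_square[of r] by (simp add: nonneg_selfadjoint)
qed

text \<open>The witnesses of the terms could vary without bound. By
  \<open>norm_le_of_nonneg\<close>, however, a common norm bound \<open>t\<close> of the sequence is
  a witness for every term, and this inequality passes to the limit.\<close>

lemma nonneg_limit:
  fixes b :: "nat \<Rightarrow> 'a::cstar_algebra"
  assumes "\<And>n. nonneg (b n)" "b \<longlonglongrightarrow> a"
  shows "nonneg a"
proof -
  have "Bseq b" using assms(2) convergent_imp_Bseq convergentI by blast
  then obtain t where t: "\<And>n. norm (b n) \<le> t" unfolding Bseq_bound by blast
  have "norm (t *\<^sub>R 1 - b n) \<le> t" for n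
  proof (rule norm_le_of_nonneg)
    show "nonneg (t *\<^sub>R 1 - b n)"
      using assms(1) t by (intro nonneg_diff_of_norm_le nonneg_selfadjoint)
  qed (simp add: assms(1))
  moreover have "(\<lambda>n. norm (t *\<^sub>R 1 - b n)) \<longlonglongrightarrow> norm (t *\<^sub>R 1 - a)"
    by (intro tendsto_intros assms(2))
  ultimately have "norm (t *\<^sub>R 1 - a) \<le> t"
    by (intro LIMSEQ_le_const2) auto
  moreover have "selfadjoint a"
    using closed_sequentially[OF closed_selfadjoint _ assms(2)] assms(1) by (simp add: nonneg_selfadjoint)
  ultimately show ?thesis unfolding nonneg_def by blast
qed


subsection \<open>Inverses in a subalgebra\<close>

lemma cstar_subalgebra_UNIV: "cstar_subalgebra UNIV"
  by (simp add: cstar_subalgebra_def)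

lemma
  assumes "cstar_subalgebra P"
  shows cstar_subalgebra_one: "1 \<in> P"
    and cstar_subalgebra_closed: "closed P"
    and cstar_subalgebra_add: "x \<in> P \<Longrightarrow> y \<in> P \<Longrightarrow> x + y \<in> P"
    and cstar_subalgebra_mult: "x \<in> P \<Longrightarrow> y \<in> P \<Longrightarrow> x * y \<in> P"
    and cstar_subalgebra_star: "x \<in> P \<Longrightarrow> star x \<in> P"
    and cstar_subalgebra_scaleR: "x \<in> P \<Longrightarrow> r *\<^sub>R x \<in> P"
  using assms unfolding cstar_subalgebra_def by (auto simp flip: scaleC_of_real)

lemma cstar_subalgebra_uminus: "cstar_subalgebra P \<Longrightarrow> x \<in> P \<Longrightarrow> - x \<in> P"
  using cstar_subalgebra_scaleR[of P x "-1"] by simp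

lemma cstar_subalgebra_diff:
  "cstar_subalgebra P \<Longrightarrow> x \<in> P \<Longrightarrow> y \<in> P \<Longrightarrow> x - y \<in> P"
  using cstar_subalgebra_add[of P x "- y"] by (simp add: cstar_subalgebra_uminus)

lemma cstar_subalgebra_zero: "cstar_subalgebra P \<Longrightarrow> 0 \<in> P"
  using cstar_subalgebra_diff[of P 1 1] by (simp add: cstar_subalgebra_one)

lemma cstar_subalgebra_sum:
  assumes P: "cstar_subalgebra P" and "\<And>i. i \<in> I \<Longrightarrow> f i \<in> P"
  shows "sum f I \<in> P"
  using assms(2) by (induction I rule: infinite_finite_induct)
    (simp_all add: cstar_subalgebra_zero[OF P] cstar_subalgebra_add[OF P])

lemma cstar_subalgebra_power:
  "cstar_subalgebra P \<Longrightarrow> x \<in> P \<Longrightarrow> x ^ n \<in> P"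
  by (induction n) (simp_all add: cstar_subalgebra_one cstar_subalgebra_mult)

text \<open>The Neumann series of \<open>1 - z\<close> has its partial sums in \<open>P\<close>, and
  \<open>P\<close> is closed.\<close>

lemma inverse_near_one:
  fixes z :: "'a::cstar_algebra"
  assumes P: "cstar_subalgebra P" and z: "z \<in> P" "norm (1 - z) < 1"
  obtains k where "k \<in> P" "z * k = 1" "k * z = 1"
proof -
  define x where "x = 1 - z"
  have x: "x \<in> P"
    using P z(1) by (simp add: x_def cstar_subalgebra_diff cstar_subalgebra_one)
  have sx: "summable (\<lambda>n. x ^ n)"
    using z(2) by (intro complete_algebra_summable_geometric) (simp add: x_def)
  define k where "k = (\<Sum>n. x ^ n)"
  have "k \<in> P"
  proof (rule closed_sequentially[OF cstar_subalgebra_closed[OF P]])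
    show "(\<Sum>i<n. x ^ i) \<in> P" for n
      by (intro cstar_subalgebra_sum cstar_subalgebra_power P x)
    show "(\<lambda>n. \<Sum>i<n. x ^ i) \<longlonglongrightarrow> k"
      unfolding k_def by (rule summable_LIMSEQ[OF sx])
  qed
  moreover have tail: "(\<Sum>n. x ^ Suc n) = k - 1"
    using suminf_split_head[OF sx] by (simp add: k_def)
  have "x * k = k - 1"
    using suminf_mult[OF sx, of x] tail by (simp add: k_def)
  moreover have "k * x = k - 1"
    using suminf_mult2[OF sx, of x] tail by (simp add: k_def power_commutes)
  ultimately show thesis
    by (intro that[of k]) (simp_all add: x_def algebra_simps)
qed

text \<open>After division by \<open>t + d\<close>, the element \<open>a + d\<close> has distance at
  most \<open>t / (t + d) < 1\<close> from 1.\<close>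

lemma inverse_nonneg_add:
  fixes a :: "'a::cstar_algebra"
  assumes P: "cstar_subalgebra P" and a: "a \<in> P" "nonneg a" and "0 < d"
  obtains k where "k \<in> P" "(a + d *\<^sub>R 1) * k = 1" "k * (a + d *\<^sub>R 1) = 1"
proof -
  obtain t where t: "norm (t *\<^sub>R 1 - a) \<le> t"
    using a by (auto simp: nonneg_def)
  then have pos: "t + d > 0"
    using \<open>0 < d\<close> norm_ge_zero[of "t *\<^sub>R 1 - a"] by linarith
  define z where "z = (1 / (t + d)) *\<^sub>R (a + d *\<^sub>R 1)"
  have z: "a + d *\<^sub>R 1 = (t + d) *\<^sub>R z"
    using pos by (simp add: z_def)
  have "z \<in> P"
    unfolding z_def by (intro cstar_subalgebra_scaleR cstar_subalgebra_add cstar_subalgebra_one P a)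
  moreover have "norm (1 - z) < 1"
  proof -
    have "(t + d) *\<^sub>R (1 - z) = t *\<^sub>R 1 - a"
      by (simp add: scaleR_right_diff_distrib flip: z) (simp add: algebra_simps)
    then have "(t + d) * norm (1 - z) \<le> t"
      using t pos by (metis abs_of_pos norm_scaleR)
    also have "t < t + d" using \<open>0 < d\<close> by simp
    finally show ?thesis
      using pos by (metis mult.right_neutral mult_less_cancel_left_pos)
  qed
  ultimately obtain k where "k \<in> P" "z * k = 1" "k * z = 1"
    by (rule inverse_near_one[OF P])
  then show thesis
    using pos by (intro that[of "(1 / (t + d)) *\<^sub>R k"]) (simp_all add: z cstar_subalgebra_scaleR[OF P])
qed

lemma selfadjoint_inverse:
  fixes g k :: "'a::cstar_algebra"
  assumes "selfadjoint g" "g * k = 1" "k * g = 1"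
  shows "selfadjoint k"
proof -
  have "star k * g = 1"
    using assms by (metis selfadjoint_def star_mult star_one)
  then show ?thesis
    unfolding selfadjoint_def using assms(2) by (metis mult.assoc mult.left_neutral mult.right_neutral)
qed


subsection \<open>Elements of the form \<open>x\<^sup>* x\<close>\<close>

lemma nonneg_sandwich_selfadjoint:
  fixes s b :: "'a::cstar_algebra"
  assumes "selfadjoint s" "nonneg b" "s * b = b * s"
  shows "nonneg (s * b * s)"
proof -
  obtain g where g: "nonneg g" "g * g = b" "\<And>y. y * b = b * y \<Longrightarrow> y * g = g * y"
    using nonneg_sqrt[OF assms(2)] by blast
  have sg: "s * g = g * s"
    using g(3) assms(3) by blast
  have "s * b * s = (s * g) * (g * s)"
    by (simp add: mult.assoc flip: g(2))
  then have "s * b * s = (s * g) * (s * g)"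
    by (simp only: sg)
  moreover have "selfadjoint (s * g)"
    using assms(1) nonneg_selfadjoint[OF g(1)] sg by (rule selfadjoint_mult)
  ultimately show ?thesis
    using nonneg_square by metis
qed

text \<open>With \<open>s\<close> the square root of \<open>a\<close>, conjugating
  \<open>l \<le> norm l\<close> by \<open>s\<close> turns \<open>l\<close> into 1 and gives
  \<open>1 \<le> norm l * a\<close>; hence \<open>d = 1 / norm l\<close>.\<close>

lemma invertible_nonneg_lower_bound:
  fixes a l :: "'a::cstar_algebra"
  assumes a: "nonneg a" and l: "a * l = 1" "l * a = 1"
  obtains d where "0 < d" "nonneg (a - d *\<^sub>R 1)"
proof -
  obtain s where s: "nonneg s" "s * s = a" "\<And>y. y * a = a * y \<Longrightarrow> y * s = s * y"
    using nonneg_sqrt[OF a] by blast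
  have ls: "l * s = s * l"
    using s(3) l by simp
  have sls: "s * l * s = 1"
    using l s(2) ls by (metis mult.assoc)
  have "l \<noteq> 0" using l by auto
  define d where "d = 1 / norm l"
  have d: "0 < d" using \<open>l \<noteq> 0\<close> by (simp add: d_def)
  have "selfadjoint (d *\<^sub>R l)"
    using selfadjoint_inverse[OF nonneg_selfadjoint[OF a] l] by (rule selfadjoint_scaleR)
  moreover have "norm (d *\<^sub>R l) \<le> 1"
    using \<open>l \<noteq> 0\<close> by (simp add: d_def)
  ultimately have "nonneg (1 *\<^sub>R 1 - d *\<^sub>R l)"
    by (rule nonneg_diff_of_norm_le)
  then have "nonneg (s * (1 *\<^sub>R 1 - d *\<^sub>R l) * s)"
    using ls nonneg_selfadjoint[OF s(1)]
    by (intro nonneg_sandwich_selfadjoint) (simp_all add: algebra_simps)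
  also have "s * (1 *\<^sub>R 1 - d *\<^sub>R l) * s = a - d *\<^sub>R 1"
    using s(2) sls by (simp add: algebra_simps)
  finally show thesis using d that by blast
qed

text \<open>
  If \<open>y\<^sup>* y \<le> 0\<close> then \<open>y y\<^sup>* \<ge> 0\<close>, because \<open>y\<^sup>* y + y y\<^sup>*\<close> is a sum of squares of self-adjoint
  elements; but \<open>y\<^sup>* y\<close> and \<open>y y\<^sup>*\<close> have the same nonzero spectrum.
\<close>

lemma star_mult_self_nonpos_imp_zero:
  fixes y :: "'a::cstar_algebra"
  assumes "nonneg (- (star y * y))"
  shows "y = 0"
proof -
  define b where "b = - (star y * y)"
  have b: "nonneg b" using assms by (simp add: b_def)
  define c where "c = y * star y"
  have "nonneg c"
  proof -
    define f where "f = y + star y"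
    define g where "g = scaleC \<i> (y - star y)"
    have "selfadjoint f"
      by (simp add: f_def selfadjoint_def star_add star_star add.commute)
    moreover have "selfadjoint g"
      by (simp add: g_def selfadjoint_def star_scaleC star_diff star_star scaleC_minus_left
          flip: scaleC_minus_right)
    ultimately have "nonneg ((1/2) *\<^sub>R (f * f + g * g) + b)"
      using b by (intro nonneg_add nonneg_scaleR nonneg_square) auto
    also have "f * f + g * g = 2 *\<^sub>R (c + star y * y)"
      by (simp add: f_def g_def c_def algebra_simps scaleR_2)
    finally show ?thesis by (simp add: b_def)
  qed
  have "b = 0"
  proof (rule ccontr)
    assume "b \<noteq> 0"
    \<comment> \<open>If \<open>t - b\<close> is invertible at \<open>t = norm b\<close>, the
      spectrum of \<open>b\<close> stays away from \<open>t\<close>, which contradicts the choice of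
      \<open>t\<close>.\<close>
    define t where "t = norm b"
    have t: "0 < t" using \<open>b \<noteq> 0\<close> by (simp add: t_def)
    obtain k where k: "(c + t *\<^sub>R 1) * k = 1" "k * (c + t *\<^sub>R 1) = 1"
      using inverse_nonneg_add[OF cstar_subalgebra_UNIV _ \<open>nonneg c\<close> t] by auto
    define w where "w = star y * k * y"
    have ck: "c * k = 1 - t *\<^sub>R k" "k * c = 1 - t *\<^sub>R k"
      using k by (simp_all add: algebra_simps eq_diff_eq)
    have "star y * y * w = star y * (c * k) * y" "w * (star y * y) = star y * (k * c) * y"
      by (simp_all add: w_def c_def mult.assoc)
    then have "star y * y * w = star y * y - t *\<^sub>R w" "w * (star y * y) = star y * y - t *\<^sub>R w"
      unfolding ck by (simp_all add: w_def algebra_simps)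
    then have "b * w = b + t *\<^sub>R w" "w * b = b + t *\<^sub>R w"
      by (simp_all add: b_def)
    then have "(t *\<^sub>R 1 - b) * (1 - w) = t *\<^sub>R 1" "(1 - w) * (t *\<^sub>R 1 - b) = t *\<^sub>R 1"
      by (simp_all add: algebra_simps)
    then have "(t *\<^sub>R 1 - b) * ((1 / t) *\<^sub>R (1 - w)) = 1" "((1 / t) *\<^sub>R (1 - w)) * (t *\<^sub>R 1 - b) = 1"
      using t by simp_all
    moreover have "nonneg (t *\<^sub>R 1 - b)"
      using b by (intro nonneg_diff_of_norm_le nonneg_selfadjoint) (simp_all add: t_def)
    ultimately obtain d where d: "0 < d" "nonneg (t *\<^sub>R 1 - b - d *\<^sub>R 1)"
      using invertible_nonneg_lower_bound by blast
    have "t *\<^sub>R 1 - b - d *\<^sub>R 1 = (t - d) *\<^sub>R 1 - b"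
      by (simp add: algebra_simps)
    with d have "norm b \<le> t - d"
      using norm_le_of_nonneg[OF b] by simp
    with d(1) show False by (simp add: t_def)
  qed
  then show ?thesis
    using norm_star_mult_self[of y] by (simp add: b_def)
qed

text \<open>Let \<open>m\<close> be the absolute value of \<open>a\<close> and
  \<open>q = m - a\<close>. Then \<open>y = x * q\<close> satisfies
  \<open>star y * y = q * a * q = - (r * q)\<^sup>2\<close>, with \<open>r\<close> a root of
  \<open>m\<close>, so \<open>y = 0\<close> by the previous lemma. This gives
  \<open>m * q = 0\<close>, then \<open>q * q = 0\<close>, and finally \<open>a = m\<close>.\<close>

lemma nonneg_star_mult_self:
  fixes x :: "'a::cstar_algebra"
  shows "nonneg (star x * x)"
proof -
  define a where "a = star x * x"
  have a: "selfadjoint a" by (simp add: a_def selfadjoint_star_mult_self)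
  obtain m where m: "nonneg m" "m * m = a * a" "\<And>y. y * (a * a) = (a * a) * y \<Longrightarrow> y * m = m * y"
    using nonneg_sqrt[OF nonneg_square[OF a]] by blast
  obtain r where r: "nonneg r" "r * r = m" "\<And>y. y * m = m * y \<Longrightarrow> y * r = r * y"
    using nonneg_sqrt[OF m(1)] by blast
  have am: "a * m = m * a"
    by (rule m(3)) (simp add: mult.assoc)
  \<comment> \<open>\<open>q\<close> is twice the negative part of \<open>a\<close>.\<close>
  define q where "q = m - a"
  have q: "selfadjoint q"
    using a nonneg_selfadjoint[OF m(1)] by (simp add: q_def selfadjoint_diff)
  have qm: "q * m = m * q" using am by (simp add: q_def algebra_simps)
  have qr: "q * r = r * q" using qm by (rule r(3))
  have aq: "(m + a) * q = 0"
    using am m(2) by (simp add: q_def algebra_simps)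
  have qq: "q * q = 2 *\<^sub>R (m * q)"
    using am m(2) by (simp add: q_def algebra_simps scaleR_2)
  have qaq: "q * a * q = - ((r * q) * (r * q))"
  proof -
    have "q * a * q = q * ((m + a) * q) - q * (m * q)"
      by (simp add: algebra_simps)
    also have "q * (m * q) = (r * q) * (r * q)"
      using qr by (simp add: mult.assoc flip: r(2)) (metis mult.assoc)
    finally show ?thesis by (simp add: aq)
  qed
  define y where "y = x * q"
  have "star y * y = q * a * q"
    using q by (simp add: y_def a_def star_mult selfadjoint_def mult.assoc)
  then have yy: "- (star y * y) = (r * q) * (r * q)"
    by (simp add: qaq)
  moreover have rq: "selfadjoint (r * q)"
    using nonneg_selfadjoint[OF r(1)] q qr by (simp add: selfadjoint_mult)
  ultimately have "nonneg (- (star y * y))"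
    by (simp add: nonneg_square)
  then have "y = 0" by (rule star_mult_self_nonpos_imp_zero)
  then have "r * q = 0"
    using yy norm_selfadjoint_square[OF rq] by simp
  then have "m * q = 0"
    by (simp add: mult.assoc flip: r(2))
  then have "q = 0"
    using qq norm_selfadjoint_square[OF q] by simp
  then show ?thesis
    using m(1) by (simp add: q_def a_def)
qed

lemma nonneg_conjugate:
  fixes b z :: "'a::cstar_algebra"
  assumes "nonneg b"
  shows "nonneg (star z * b * z)"
proof -
  obtain s where s: "nonneg s" "s * s = b"
    using nonneg_sqrt[OF assms] by blast
  then have "star z * b * z = star (s * z) * (s * z)"
    using nonneg_selfadjoint[OF s(1)] by (simp add: star_mult selfadjoint_def mult.assoc flip: s(2))
  then show ?thesis by (simp add: nonneg_star_mult_self)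
qed


subsection \<open>Positive kernels\<close>

text \<open>
  A matrix over \<open>P\<close> that is positive on vectors over \<open>P\<close> is positive on vectors over the whole algebra:
  one step of a Cholesky decomposition stays inside \<open>P\<close>. The Schur complement is taken after adding
  \<open>d\<close> to the last diagonal entry, which makes that entry invertible.
\<close>

lemma kernel_complete_square:
  fixes G :: "nat \<Rightarrow> nat \<Rightarrow> 'a::cstar_algebra" and t :: "nat \<Rightarrow> 'a"
  assumes herm: "\<And>i j. i \<le> n \<Longrightarrow> j \<le> n \<Longrightarrow> star (G i j) = G j i"
    and g: "g = G n n + d *\<^sub>R 1" "g * k = 1" "k * g = 1"
  defines "c \<equiv> \<Sum>j<n. G n j * t j"
  shows "(\<Sum>i<Suc n. \<Sum>j<Suc n. star (t i) * G i j * t j) + d *\<^sub>R (star (t n) * t n) =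
    (\<Sum>i<n. \<Sum>j<n. star (t i) * (G i j - G i n * k * G n j) * t j) + star (t n + k * c) * g * (t n + k * c)"
proof -
  have sg: "star g = g" using herm[of n n] by (simp add: g(1) star_add star_scaleR)
  then have sk: "star k = k" using selfadjoint_inverse[of g k] g by (simp add: selfadjoint_def)
  have sc: "star c = (\<Sum>i<n. star (t i) * G i n)"
    unfolding c_def star_sum by (intro sum.cong) (simp_all add: star_mult herm)
  define S where "S = (\<Sum>i<n. \<Sum>j<n. star (t i) * G i j * t j)"
  have "(\<Sum>i<n. \<Sum>j<n. star (t i) * (G i j - G i n * k * G n j) * t j) =
      S - (\<Sum>i<n. \<Sum>j<n. star (t i) * G i n * (k * (G n j * t j)))"
    by (simp add: S_def algebra_simps sum_subtractf)
  also have "(\<Sum>i<n. \<Sum>j<n. star (t i) * G i n * (k * (G n j * t j))) = star c * (k * c)"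
  proof -
    have "k * c = (\<Sum>j<n. k * (G n j * t j))"
      by (simp add: c_def sum_distrib_left)
    then show ?thesis by (simp add: sc sum_product)
  qed
  finally have 1: "(\<Sum>i<n. \<Sum>j<n. star (t i) * (G i j - G i n * k * G n j) * t j) = S - star c * (k * c)" .
  have "star (t n) * c = (\<Sum>j<n. star (t n) * G n j * t j)"
    by (simp add: c_def sum_distrib_left mult.assoc)
  moreover have "star c * t n = (\<Sum>i<n. star (t i) * G i n * t n)"
    by (simp add: sc sum_distrib_right)
  ultimately have 2: "(\<Sum>i<Suc n. \<Sum>j<Suc n. star (t i) * G i j * t j) =
      S + star c * t n + star (t n) * c + star (t n) * G n n * t n"
    by (simp add: S_def sum.distrib algebra_simps)
  have gk: "g * (k * z) = z" "k * (g * z) = z" for z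
    using g by (simp_all flip: mult.assoc)
  have 3: "star (t n + k * c) * g * (t n + k * c) =
      star (t n) * g * t n + star (t n) * c + star c * t n + star c * (k * c)"
    by (simp add: star_add star_mult sk algebra_simps gk)
  show ?thesis
    unfolding 1 2 3 by (simp add: g(1) algebra_simps)
qed

lemma nonneg_kernel:
  fixes G :: "nat \<Rightarrow> nat \<Rightarrow> 'a::cstar_algebra" and t :: "nat \<Rightarrow> 'a"
  assumes P: "cstar_subalgebra P"
    and "\<And>i j. i < n \<Longrightarrow> j < n \<Longrightarrow> G i j \<in> P"
    and "\<And>i j. i < n \<Longrightarrow> j < n \<Longrightarrow> star (G i j) = G j i"
    and "\<And>p. (\<And>i. i < n \<Longrightarrow> p i \<in> P) \<Longrightarrow> nonneg (\<Sum>i<n. \<Sum>j<n. star (p i) * G i j * p j)"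
  shows "nonneg (\<Sum>i<n. \<Sum>j<n. star (t i) * G i j * t j)"
  using assms(2-4)
proof (induction n arbitrary: G)
  case (Suc n)
  note inP = Suc.prems(1) and herm = Suc.prems(2) and pos = Suc.prems(3)
  define S where "S = (\<Sum>i<Suc n. \<Sum>j<Suc n. star (t i) * G i j * t j)"
  \<comment> \<open>Testing with the last unit vector, which has entries in \<open>P\<close>,
    isolates the corner entry.\<close>
  have "(\<Sum>i<Suc n. \<Sum>j<Suc n. star (if i = n then 1 else 0) * G i j * (if j = n then 1 else 0)) = G n n"
    by (simp add: if_distrib[of star] if_distrib[of "\<lambda>x. x * _"] if_distrib[of "\<lambda>x. _ * x"] cong: if_cong)
  then have Gnn: "nonneg (G n n)"
    using pos[of "\<lambda>i. if i = n then 1 else 0"] P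
    by (auto simp: cstar_subalgebra_one cstar_subalgebra_zero)
  have perturbed: "nonneg (S + d *\<^sub>R (star (t n) * t n))" if "0 < d" for d
  proof -
    define g where "g = G n n + d *\<^sub>R 1"
    obtain k where k: "k \<in> P" "g * k = 1" "k * g = 1"
      using inverse_nonneg_add[OF P inP[of n n] Gnn \<open>0 < d\<close>] by (auto simp: g_def)
    have "nonneg (d *\<^sub>R (1 :: 'a))"
      using nonneg_square[of "1 :: 'a"] \<open>0 < d\<close> by (intro nonneg_scaleR) auto
    then have g: "nonneg g"
      unfolding g_def using Gnn by (rule nonneg_add[rotated])
    have sk: "star k = k"
      using selfadjoint_inverse[OF nonneg_selfadjoint[OF g] k(2,3)] by (simp add: selfadjoint_def)
    have square: "(\<Sum>i<Suc n. \<Sum>j<Suc n. star (p i) * G i j * p j) + d *\<^sub>R (star (p n) * p n) =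
        (\<Sum>i<n. \<Sum>j<n. star (p i) * (G i j - G i n * k * G n j) * p j) +
        star (p n + k * (\<Sum>j<n. G n j * p j)) * g * (p n + k * (\<Sum>j<n. G n j * p j))" for p :: "nat \<Rightarrow> 'a"
      by (rule kernel_complete_square[where n = n and G = G, OF _ g_def k(2,3)]) (simp add: herm)
    have "nonneg (\<Sum>i<n. \<Sum>j<n. star (t i) * (G i j - G i n * k * G n j) * t j)"
    proof (rule Suc.IH)
      fix i j assume "i < n" "j < n"
      then show "G i j - G i n * k * G n j \<in> P"
        by (intro cstar_subalgebra_diff cstar_subalgebra_mult P inP k(1)) auto
      show "star (G i j - G i n * k * G n j) = G j i - G j n * k * G n i"
        using \<open>i < n\<close> \<open>j < n\<close> by (simp add: star_diff star_mult herm sk mult.assoc)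
    next
      fix p :: "nat \<Rightarrow> 'a"
      assume p: "\<And>i. i < n \<Longrightarrow> p i \<in> P"
      \<comment> \<open>The last coordinate is chosen to make the completed square vanish, so only
        the form of the Schur complement is left.\<close>
      define p' where "p' = p(n := - (k * (\<Sum>j<n. G n j * p j)))"
      have "k * (\<Sum>j<n. G n j * p j) \<in> P"
        using p by (intro cstar_subalgebra_mult cstar_subalgebra_sum P k(1) inP) auto
      then have p': "p' i \<in> P" if "i < Suc n" for i
        using that p by (auto simp: p'_def cstar_subalgebra_uminus[OF P])
      have "nonneg ((\<Sum>i<Suc n. \<Sum>j<Suc n. star (p' i) * G i j * p' j) + d *\<^sub>R (star (p' n) * p' n))"
        using \<open>0 < d\<close> by (intro nonneg_add nonneg_scaleR pos p' nonneg_star_mult_self) auto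
      also have "\<dots> = (\<Sum>i<n. \<Sum>j<n. star (p i) * (G i j - G i n * k * G n j) * p j)"
        unfolding square by (simp add: p'_def)
      finally show "nonneg (\<Sum>i<n. \<Sum>j<n. star (p i) * (G i j - G i n * k * G n j) * p j)" .
    qed
    then show ?thesis
      unfolding S_def square by (intro nonneg_add nonneg_conjugate g)
  qed
  \<comment> \<open>The perturbation \<open>d\<close> is removed along
    \<open>1 / (m + 1)\<close>.\<close>
  have "(\<lambda>m. S + inverse (real (Suc m)) *\<^sub>R (star (t n) * t n)) \<longlonglongrightarrow> S + 0 *\<^sub>R (star (t n) * t n)"
    by (intro tendsto_intros LIMSEQ_inverse_real_of_nat)
  then show ?case
    using nonneg_limit[of "\<lambda>m. S + inverse (real (Suc m)) *\<^sub>R (star (t n) * t n)" S] perturbed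
    by (simp add: S_def)
qed simp


section \<open>Conditional expectations of finite index\<close>

locale expectation =
  fixes E :: "'a::cstar_algebra \<Rightarrow> 'a" and P :: "'a set"
  assumes P: "cstar_subalgebra P" and E: "conditional_expectation E P"
begin

lemma E_in: "E x \<in> P"
  and E_id: "p \<in> P \<Longrightarrow> E p = p"
  and E_add: "E (x + y) = E x + E y"
  and E_scaleC: "E (scaleC c x) = scaleC c (E x)"
  and E_left: "p \<in> P \<Longrightarrow> E (p * x) = p * E x"
  and E_right: "p \<in> P \<Longrightarrow> E (x * p) = E x * p"
  and E_positive: "positive_in UNIV x \<Longrightarrow> positive_in P (E x)"
  and norm_E: "norm (E x) \<le> norm x"
  using E unfolding conditional_expectation_def by blast+

lemma E_scaleR: "E (r *\<^sub>R x) = r *\<^sub>R E x"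
  using E_scaleC[of "complex_of_real r" x] by (simp add: scaleC_of_real)

lemma bounded_linear_E: "bounded_linear E"
  by (rule bounded_linear_intro[where K = 1]) (simp_all add: E_add E_scaleR norm_E)

lemma E_diff: "E (x - y) = E x - E y"
  by (rule linear_diff[OF bounded_linear.linear[OF bounded_linear_E]])

lemma E_sum: "E (sum f I) = (\<Sum>i\<in>I. E (f i))"
  by (rule linear_sum[OF bounded_linear.linear[OF bounded_linear_E]])

lemma nonneg_E_star_mult_self: "nonneg (E (star x * x))"
proof -
  have "positive_in P (E (star x * x))"
    by (rule E_positive) (auto simp: positive_in_def)
  then show ?thesis
    using nonneg_star_mult_self by (metis positive_in_def)
qed

text \<open>Positivity gives control only over elements \<open>star x * x\<close>; a self-adjoint
  \<open>h\<close> is reached from \<open>4 h = (h + 1)\<^sup>2 - (h - 1)\<^sup>2\<close>.\<close>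

lemma E_selfadjoint:
  assumes "selfadjoint h"
  shows "selfadjoint (E h)"
proof -
  have "selfadjoint (E (star (h + 1) * (h + 1)) - E (star (h - 1) * (h - 1)))"
    by (intro selfadjoint_diff nonneg_selfadjoint nonneg_E_star_mult_self)
  also have "E (star (h + 1) * (h + 1)) - E (star (h - 1) * (h - 1)) = 4 *\<^sub>R E h"
  proof -
    have "star (h + 1) * (h + 1) - star (h - 1) * (h - 1) = 4 *\<^sub>R h"
      using assms scaleR_left.add[of 2 2 h]
      by (simp add: selfadjoint_def star_add star_diff algebra_simps scaleR_2)
    then show ?thesis by (simp flip: E_diff E_scaleR)
  qed
  finally show ?thesis
    using selfadjoint_scaleR[of "4 *\<^sub>R E h" "1/4"] by simp
qed

text \<open>Apply \<open>E_selfadjoint\<close> to the real part of \<open>x\<close> and to its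
  imaginary part, both up to a real factor.\<close>

lemma E_star: "E (star x) = star (E x)"
proof -
  have "selfadjoint (E (x + star x))"
    by (rule E_selfadjoint) (simp add: selfadjoint_def star_add star_star add.commute)
  moreover have "selfadjoint (E (scaleC \<i> (x - star x)))"
    by (rule E_selfadjoint)
      (simp add: selfadjoint_def star_scaleC star_diff star_star scaleC_minus_left flip: scaleC_minus_right)
  ultimately have 1: "star (E x) + star (E (star x)) = E x + E (star x)"
    and "scaleC (- \<i>) (star (E x) - star (E (star x))) = scaleC \<i> (E x - E (star x))"
    by (simp_all add: selfadjoint_def E_add E_diff E_scaleC star_add star_diff star_scaleC)
  then have "scaleC \<i> (scaleC (- \<i>) (star (E x) - star (E (star x)))) = scaleC \<i> (scaleC \<i> (E x - E (star x)))"
    by simp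
  then have "star (E x) - star (E (star x)) = - (E x - E (star x))"
    unfolding scaleC_scaleC by (simp add: scaleC_minus_left)
  then have 2: "star (E x) = E (star x) + star (E (star x)) - E x"
    by (simp add: algebra_simps)
  have 3: "star (E x) = E x + E (star x) - star (E (star x))"
    using 1 by (simp add: eq_diff_eq)
  \<comment> \<open>Adding the two expressions cancels \<open>E x\<close> and
    \<open>star (E (star x))\<close>.\<close>
  have "2 *\<^sub>R star (E x) = 2 *\<^sub>R E (star x)"
    unfolding scaleR_2 using arg_cong2[where f = "(+)", OF 2 3] by simp
  then show ?thesis by simp
qed

lemma E_sum_right:
  assumes "\<And>j. j \<in> J \<Longrightarrow> p j \<in> P"
  shows "E (y * (\<Sum>j\<in>J. u j * p j)) = (\<Sum>j\<in>J. E (y * u j) * p j)"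
proof -
  have "y * (\<Sum>j\<in>J. u j * p j) = (\<Sum>j\<in>J. y * u j * p j)"
    by (simp add: sum_distrib_left mult.assoc)
  then show ?thesis
    using assms by (simp add: E_sum E_right)
qed

text \<open>
  The matrix with entries \<open>E (u\<^sub>i\<^sup>* u\<^sub>j) - c E (u\<^sub>i\<^sup>* x) E (x\<^sup>* u\<^sub>j)\<close> is positive on vectors over \<open>P\<close>
  by the Cauchy--Schwarz inequality for the \<open>P\<close>-valued inner product \<open>E (x\<^sup>* y)\<close>.
\<close>

lemma nonneg_gram_diff:
  fixes u t :: "nat \<Rightarrow> 'a" and n :: nat
  assumes c: "0 \<le> c" "c * (norm x)\<^sup>2 \<le> 1"
  defines "z \<equiv> \<Sum>i<n. t i * E (star (u i) * x)"
  shows "nonneg ((\<Sum>i<n. \<Sum>j<n. t i * E (star (u i) * u j) * star (t j)) - c *\<^sub>R (z * star z))"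
proof -
  define G where "G i j = E (star (u i) * u j) - c *\<^sub>R (E (star (u i) * x) * E (star x * u j))" for i j
  \<comment> \<open>The coefficients \<open>t i\<close> are arbitrary in the algebra, whereas
    Cauchy--Schwarz is available only for vectors over \<open>P\<close>;
    \<open>nonneg_kernel\<close> bridges the gap.\<close>
  have "nonneg (\<Sum>i<n. \<Sum>j<n. star (star (t i)) * G i j * star (t j))"
  proof (rule nonneg_kernel[OF P])
    show "G i j \<in> P" for i j
      unfolding G_def by (intro cstar_subalgebra_diff cstar_subalgebra_scaleR cstar_subalgebra_mult P E_in)
    show "star (G i j) = G j i" for i j
      by (simp add: G_def star_diff star_scaleR star_mult star_star flip: E_star)
  next
    fix p :: "nat \<Rightarrow> 'a"
    assume p: "\<And>i. i < n \<Longrightarrow> p i \<in> P"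
    define y where "y = (\<Sum>i<n. u i * p i)"
    define q where "q = E (star x * y)"
    have q: "q \<in> P" "star q \<in> P" by (simp_all add: q_def E_in cstar_subalgebra_star[OF P])
    have right: "E (a * y) = (\<Sum>j<n. E (a * u j) * p j)" for a
      unfolding y_def using p by (intro E_sum_right) auto
    have left: "E (star y * a) = (\<Sum>i<n. star (p i) * E (star (u i) * a))" for a
    proof -
      have "E (star y * a) = star (E (star a * y))"
        by (simp add: star_mult star_star flip: E_star)
      also have "\<dots> = (\<Sum>i<n. star (p i) * E (star (u i) * a))"
        by (simp add: right star_sum star_mult star_star flip: E_star)
      finally show ?thesis .
    qed
    have sq: "star q = E (star y * x)"
      by (simp add: q_def star_mult star_star flip: E_star)
    have "(\<Sum>i<n. \<Sum>j<n. star (p i) * G i j * p j) =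
        (\<Sum>i<n. star (p i) * (\<Sum>j<n. E (star (u i) * u j) * p j)) -
        c *\<^sub>R ((\<Sum>i<n. star (p i) * E (star (u i) * x)) * (\<Sum>j<n. E (star x * u j) * p j))"
      unfolding sum_product
      by (simp add: G_def algebra_simps sum_subtractf sum_distrib_left scaleR_sum_right)
    also have "\<dots> = E (star y * y) - c *\<^sub>R (star q * q)"
      unfolding right[symmetric] left[symmetric] sq[symmetric] q_def[symmetric] ..
    \<comment> \<open>The square of \<open>y - c x q\<close> is completed, with \<open>c\<close> in
      the role of \<open>1 / (norm x)\<^sup>2\<close>. The remainder is nonnegative because
      \<open>c E (x\<^sup>* x) \<le> 1\<close>.\<close>
    also have "\<dots> = E (star (y - c *\<^sub>R (x * q)) * (y - c *\<^sub>R (x * q))) +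
        c *\<^sub>R (star q * (1 *\<^sub>R 1 - c *\<^sub>R E (star x * x)) * q)"
    proof -
      have "star (y - c *\<^sub>R (x * q)) * (y - c *\<^sub>R (x * q)) =
          star y * y - c *\<^sub>R (star y * x * q) - c *\<^sub>R (star q * (star x * y))
            + (c * c) *\<^sub>R (star q * (star x * x) * q)"
        by (simp add: star_diff star_scaleR star_mult algebra_simps)
      then have "E (star (y - c *\<^sub>R (x * q)) * (y - c *\<^sub>R (x * q))) =
          E (star y * y) - c *\<^sub>R (star q * q) - c *\<^sub>R (star q * q) + (c * c) *\<^sub>R (star q * E (star x * x) * q)"
        using q by (simp only: E_add E_diff E_scaleR E_left E_right flip: sq q_def)
      then show ?thesis
        by (simp add: algebra_simps)
    qed
    finally have eq: "(\<Sum>i<n. \<Sum>j<n. star (p i) * G i j * p j) = \<dots>" .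
    have "norm (c *\<^sub>R E (star x * x)) \<le> 1"
      using c mult_left_mono[OF norm_E[of "star x * x"] c(1)] by (simp add: norm_star_mult_self)
    then have "nonneg (1 *\<^sub>R 1 - c *\<^sub>R E (star x * x))"
      by (intro nonneg_diff_of_norm_le selfadjoint_scaleR E_selfadjoint selfadjoint_star_mult_self)
    then show "nonneg (\<Sum>i<n. \<Sum>j<n. star (p i) * G i j * p j)"
      unfolding eq using c(1)
      by (intro nonneg_add nonneg_scaleR nonneg_conjugate nonneg_E_star_mult_self)
  qed
  also have "(\<Sum>i<n. \<Sum>j<n. star (star (t i)) * G i j * star (t j)) =
      (\<Sum>i<n. \<Sum>j<n. t i * E (star (u i) * u j) * star (t j)) - c *\<^sub>R (z * star z)"
  proof -
    have "star z = (\<Sum>j<n. E (star x * u j) * star (t j))"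
      by (simp add: z_def star_sum star_mult star_star flip: E_star)
    then have "z * star z = (\<Sum>i<n. \<Sum>j<n. t i * E (star (u i) * x) * (E (star x * u j) * star (t j)))"
      unfolding z_def by (simp add: sum_product)
    then show ?thesis
      by (simp add: G_def star_star algebra_simps sum_subtractf scaleR_sum_right)
  qed
  finally show ?thesis .
qed

text \<open>The chain \<open>0 \<le> c z z\<^sup>* \<le> K \<le> norm K\<close> turns the order
  inequality into one between norms.\<close>

lemma norm_gram_le:
  fixes u t :: "nat \<Rightarrow> 'a" and n :: nat
  assumes c: "0 \<le> c" "c * (norm x)\<^sup>2 \<le> 1"
  shows "c * (norm (\<Sum>i<n. t i * E (star (u i) * x)))\<^sup>2 \<le>
    norm (\<Sum>i<n. \<Sum>j<n. t i * E (star (u i) * u j) * star (t j))"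
proof -
  define K where "K = (\<Sum>i<n. \<Sum>j<n. t i * E (star (u i) * u j) * star (t j))"
  define z where "z = (\<Sum>i<n. t i * E (star (u i) * x))"
  have diff: "nonneg (K - c *\<^sub>R (z * star z))"
    unfolding K_def z_def by (rule nonneg_gram_diff[OF c])
  have z: "nonneg (c *\<^sub>R (z * star z))"
    using nonneg_scaleR[OF nonneg_star_mult_self c(1), of "star z"] by (simp add: star_star)
  have "selfadjoint K"
    using nonneg_add[OF diff z] by (simp add: nonneg_selfadjoint)
  then have "nonneg (norm K *\<^sub>R 1 - K)"
    by (simp add: nonneg_diff_of_norm_le)
  from nonneg_add[OF this diff] have "norm (c *\<^sub>R (z * star z)) \<le> norm K"
    by (intro norm_le_of_nonneg z) simp
  then show ?thesis
    using c(1) norm_star_mult_self[of "star z"] by (simp add: star_star norm_star flip: K_def z_def)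
qed

end

section \<open>Quasi-bases, the index element and the defect\<close>

locale finite_index_expectation = expectation E P
  for E :: "'a::cstar_algebra \<Rightarrow> 'a" and P +
  fixes n :: nat and u v :: "nat \<Rightarrow> 'a"
  assumes quasi_basis: "quasi_basis E n u v"
begin

definition d :: 'a where "d = (\<Sum>i<n. u i * v i)"

lemma quasi_basis_left: "(\<Sum>i<n. u i * E (v i * x)) = x"
  and quasi_basis_right: "(\<Sum>i<n. E (x * u i) * v i) = x"
  using quasi_basis unfolding quasi_basis_def by metis+

text \<open>The adjoint of \<open>quasi_basis_right\<close>. It expands \<open>x\<close> by means of
  the inner products \<open>E (star (u i) * x)\<close> that occur in the Gram inequality.\<close>

lemma quasi_basis_star: "(\<Sum>i<n. star (v i) * E (star (u i) * x)) = x"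
proof -
  have "(\<Sum>i<n. star (v i) * E (star (u i) * x)) = star (\<Sum>i<n. E (star x * u i) * v i)"
    by (simp add: star_sum star_mult star_star flip: E_star)
  then show ?thesis by (simp add: quasi_basis_right star_star)
qed

text \<open>Expand \<open>x * u i\<close> with the left identity, exchange the sums, and collapse
  the inner one to \<open>v j * x\<close> with the right identity.\<close>

lemma d_central: "d * x = x * d"
proof -
  have "x * d = (\<Sum>i<n. x * u i * v i)"
    by (simp add: d_def sum_distrib_left mult.assoc)
  also have "\<dots> = (\<Sum>i<n. (\<Sum>j<n. u j * E (v j * (x * u i))) * v i)"
    by (simp add: quasi_basis_left)
  also have "\<dots> = (\<Sum>j<n. u j * (\<Sum>i<n. E (v j * x * u i) * v i))"
    unfolding sum_distrib_left sum_distrib_right by (subst sum.swap) (simp add: mult.assoc)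
  also have "\<dots> = d * x"
    unfolding quasi_basis_right by (simp add: d_def sum_distrib_right mult.assoc)
  finally show ?thesis by simp
qed

text \<open>The Rohlin projection \<open>e\<close> satisfies \<open>e x = d e E (e x)\<close>, where \<open>d\<close> is the index.\<close>

definition defect :: "'a \<Rightarrow> 'a \<Rightarrow> 'a"
  where "defect e x = e * x - d * e * E (e * x)"

lemma defect_sum:
  assumes "\<And>i. i \<in> I \<Longrightarrow> p i \<in> P"
  shows "defect e (\<Sum>i\<in>I. y i * p i) = (\<Sum>i\<in>I. defect e (y i) * p i)"
proof -
  have "E (e * (\<Sum>i\<in>I. y i * p i)) = (\<Sum>i\<in>I. E (e * y i) * p i)"
    by (rule E_sum_right) (rule assms)
  then show ?thesis
    unfolding defect_def by (simp only: sum_distrib_left left_diff_distrib sum_subtractf mult.assoc)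
qed

text \<open>With \<open>t i = defect e (star (v i))\<close>, right \<open>P\<close>-linearity turns
  the sum in \<open>norm_gram_le\<close> into \<open>defect e x\<close>, and the quasi-basis
  identities collapse the Gram sum to the expression on the right. Stated for arbitrary
  \<open>e\<close>, the bound applies to each term of a sequence that is a central projection only
  in the limit.\<close>

lemma defect_bound:
  assumes "0 \<le> c" "c * (norm x)\<^sup>2 \<le> 1" and d: "selfadjoint d"
  shows "c * (norm (defect e x))\<^sup>2 \<le>
    norm (e * d * star e - e * star e * star e * d - d * e * e * star e + d * e * E (e * star e) * star e * d)"
proof -
  define t where "t i = defect e (star (v i))" for i
  have t: "(\<Sum>i<n. t i * E (star (u i) * y)) = defect e y" for y
    using defect_sum[of "{..<n}" "\<lambda>i. E (star (u i) * y)" e "\<lambda>i. star (v i)"]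
    by (simp add: t_def E_in quasi_basis_star)
  have st: "star (t j) = v j * star e - E (v j * star e) * star e * d" for j
    using d by (simp add: t_def defect_def star_diff star_mult star_star mult.assoc selfadjoint_def flip: E_star)
  \<comment> \<open>Summing over \<open>i\<close> first rebuilds
    \<open>defect e (u j)\<close>.\<close>
  have "(\<Sum>i<n. \<Sum>j<n. t i * E (star (u i) * u j) * star (t j)) = (\<Sum>j<n. defect e (u j) * star (t j))"
    by (subst sum.swap) (simp add: t flip: sum_distrib_right)
  also have "\<dots> = (\<Sum>j<n. e * (u j * v j) * star e) - (\<Sum>j<n. e * (u j * E (v j * star e)) * star e * d)
      - (\<Sum>j<n. d * e * (E (e * u j) * v j) * star e) + (\<Sum>j<n. d * e * (E (e * u j) * E (v j * star e)) * star e * d)"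
    by (simp add: st defect_def algebra_simps sum.distrib sum_subtractf)
  also have "(\<Sum>j<n. e * (u j * v j) * star e) = e * d * star e"
    by (simp add: d_def sum_distrib_left sum_distrib_right)
  also have "(\<Sum>j<n. e * (u j * E (v j * star e)) * star e * d) = e * star e * star e * d"
    by (simp add: quasi_basis_left flip: sum_distrib_left sum_distrib_right)
  also have "(\<Sum>j<n. d * e * (E (e * u j) * v j) * star e) = d * e * e * star e"
    by (simp add: quasi_basis_right flip: sum_distrib_left sum_distrib_right)
  also have "(\<Sum>j<n. d * e * (E (e * u j) * E (v j * star e)) * star e * d) = d * e * E (e * star e) * star e * d"
  proof -
    have "(\<Sum>j<n. E (e * u j) * E (v j * star e)) = E ((\<Sum>j<n. E (e * u j) * v j) * star e)"
      by (simp add: sum_distrib_right E_sum E_left E_in mult.assoc)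
    then show ?thesis
      by (simp add: quasi_basis_right flip: sum_distrib_left sum_distrib_right)
  qed
  finally show ?thesis
    using norm_gram_le[OF assms(1,2), where n = n and t = t and u = u] by (simp add: t)
qed

end


section \<open>Computations in the sequence algebra\<close>

lemma abs_seq_alg_eq_iff:
  assumes "Bseq x" "Bseq y"
  shows "abs_seq_alg x = abs_seq_alg y \<longleftrightarrow> (\<lambda>n. x n - y n) \<longlonglongrightarrow> 0"
  using Quotient3_rel[OF Quotient3_seq_alg, of x y] assms by (simp add: seq_rel_def)

lemma seq_alg_representative:
  obtains x where "Bseq x" "X = abs_seq_alg x"
proof
  have "seq_rel (rep_seq_alg X) (rep_seq_alg X)"
    by (rule Quotient3_rep_reflp[OF Quotient3_seq_alg])
  then show "Bseq (rep_seq_alg X)"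
    by (simp add: seq_rel_def)
  show "X = abs_seq_alg (rep_seq_alg X)"
    by (rule Quotient3_abs_rep[OF Quotient3_seq_alg, symmetric])
qed

lemma Bseq_star: "Bseq x \<Longrightarrow> Bseq (\<lambda>n. star (x n :: 'a::cstar_algebra))"
  by (simp add: Bseq_bound norm_star)

lemma Bseq_minus:
  fixes x y :: "nat \<Rightarrow> 'a::real_normed_vector"
  assumes "Bseq x" "Bseq y"
  shows "Bseq (\<lambda>n. x n - y n)"
  using Bseq_plus[of x "\<lambda>n. - y n"] assms by (simp add: Bseq_bound)

lemma
  assumes "Bseq x" "Bseq y"
  shows abs_seq_alg_plus: "abs_seq_alg (\<lambda>n. x n + y n) = abs_seq_alg x + abs_seq_alg y"
    and abs_seq_alg_times: "abs_seq_alg (\<lambda>n. x n * y n) = abs_seq_alg x * abs_seq_alg y"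
    and abs_seq_alg_minus: "abs_seq_alg (\<lambda>n. x n - y n) = abs_seq_alg x - abs_seq_alg y"
proof -
  have rel: "seq_rel x x" "seq_rel y y"
    using assms by (simp_all add: seq_rel_def)
  show "abs_seq_alg (\<lambda>n. x n + y n) = abs_seq_alg x + abs_seq_alg y"
    "abs_seq_alg (\<lambda>n. x n * y n) = abs_seq_alg x * abs_seq_alg y"
    "abs_seq_alg (\<lambda>n. x n - y n) = abs_seq_alg x - abs_seq_alg y"
  proof -
    have "seq_rel (\<lambda>n. - y n) (\<lambda>n. - y n)"
      using assms by (simp add: seq_rel_def Bseq_bound)
    then show "abs_seq_alg (\<lambda>n. x n - y n) = abs_seq_alg x - abs_seq_alg y"
      using rel by (simp add: minus_seq_alg_def plus_seq_alg.abs_eq uminus_seq_alg.abs_eq)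
  qed (simp_all add: rel plus_seq_alg.abs_eq times_seq_alg.abs_eq)
qed

lemma abs_seq_alg_star: "Bseq x \<Longrightarrow> abs_seq_alg (\<lambda>n. star (x n)) = star (abs_seq_alg x)"
  by (simp add: seq_rel_def star_seq_alg.abs_eq)

lemma abs_seq_alg_const: "abs_seq_alg (\<lambda>_. a) = const_seq a"
  by (simp add: const_seq.abs_eq)

lemma const_seq_one: "const_seq 1 = 1"
  by (simp add: one_seq_alg_def flip: abs_seq_alg_const)

lemma const_seq_mult: "const_seq (a * b) = const_seq a * const_seq b"
  using abs_seq_alg_times[of "\<lambda>_. a" "\<lambda>_. b"] by (simp add: abs_seq_alg_const)

text \<open>Once both products are near 1 they are invertible inside \<open>P\<close>. This yields a
  right and a left inverse of \<open>h n\<close> in \<open>P\<close>, and the two coincide.\<close>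

lemma tendsto_inverse_imp_invertible_in:
  fixes h c :: "nat \<Rightarrow> 'a::cstar_algebra"
  assumes P: "cstar_subalgebra P" and "\<And>n. h n \<in> P" "\<And>n. c n \<in> P"
    and "(\<lambda>n. h n * c n) \<longlonglongrightarrow> 1" "(\<lambda>n. c n * h n) \<longlonglongrightarrow> 1"
  shows "\<forall>\<^sub>F n in sequentially. invertible_in P (h n)"
proof -
  have ev: "\<forall>\<^sub>F n in sequentially. norm (1 - z n) < 1" if "z \<longlonglongrightarrow> 1" for z :: "nat \<Rightarrow> 'a"
    using tendstoD[OF that, of 1] by (simp add: dist_norm norm_minus_commute)
  from ev[OF assms(4)] ev[OF assms(5)] show ?thesis
  proof eventually_elim
    case (elim n)
    obtain k where k: "k \<in> P" "h n * c n * k = 1"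
      using inverse_near_one[OF P _ elim(1)] assms(2,3) cstar_subalgebra_mult[OF P] by metis
    obtain l where l: "l \<in> P" "l * (c n * h n) = 1"
      using inverse_near_one[OF P _ elim(2)] assms(2,3) cstar_subalgebra_mult[OF P] by metis
    have "c n * k = l * (c n * h n) * (c n * k)" by (simp add: l)
    also have "\<dots> = l * c n * (h n * c n * k)" by (simp add: mult.assoc)
    also have "\<dots> = l * c n" by (simp add: k)
    finally have "c n * k = l * c n" .
    then have "h n * (c n * k) = 1" "(c n * k) * h n = 1"
      using k l by (simp_all add: mult.assoc)
    then show ?case
      unfolding invertible_in_def using assms(2,3) k(1) cstar_subalgebra_mult[OF P] by blast
  qed
qed

context expectation
begin

lemma Bseq_E: "Bseq x \<Longrightarrow> Bseq (\<lambda>n. E (x n))"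
  unfolding Bseq_bound using norm_E order_trans by meson

lemma abs_seq_alg_E: "Bseq x \<Longrightarrow> abs_seq_alg (\<lambda>n. E (x n)) = E_inf E (abs_seq_alg x)"
  by (simp add: E_inf_abs[OF E])

end

section \<open>The Rohlin projection and the homomorphism it induces\<close>

locale rohlin = finite_index_expectation E P n u v
  for E :: "'a::cstar_algebra \<Rightarrow> 'a" and P n u v +
  fixes X :: "'a seq_alg" and w :: 'a and e :: "nat \<Rightarrow> 'a"
  assumes X_central: "X \<in> central_seq_alg" and X_projection: "projection X"
    and w_d: "w * d = 1" and d_w: "d * w = 1" and E_X: "E_inf E X = const_seq w"
    and Bseq_e: "Bseq e" and X_e: "X = abs_seq_alg e"
begin

lemma star_X: "star X = X" and X_X: "X * X = X"
  using X_projection by (simp_all add: projection_def selfadjoint_def)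

lemma const_X: "const_seq a * X = X * const_seq a"
  using X_central by (auto simp: central_seq_alg_def)

lemma E_e_tendsto: "(\<lambda>m. E (e m)) \<longlonglongrightarrow> w"
proof -
  have "abs_seq_alg (\<lambda>m. E (e m)) = abs_seq_alg (\<lambda>_. w)"
    using Bseq_e E_X by (simp add: abs_seq_alg_E abs_seq_alg_const flip: X_e)
  then show ?thesis
    using Bseq_e by (subst (asm) abs_seq_alg_eq_iff) (simp_all add: Bseq_E LIM_zero_iff)
qed

lemma w_in: "w \<in> P"
  by (rule closed_sequentially[OF cstar_subalgebra_closed[OF P] _ E_e_tendsto]) (rule E_in)

lemma selfadjoint_w: "selfadjoint w"
proof -
  have "(\<lambda>m. star (e m) - e m) \<longlonglongrightarrow> 0"
    using Bseq_e star_X by (subst abs_seq_alg_eq_iff[symmetric]) (simp_all add: Bseq_star abs_seq_alg_star flip: X_e)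
  then have "(\<lambda>m. E (star (e m) - e m)) \<longlonglongrightarrow> E 0"
    by (rule bounded_linear.tendsto[OF bounded_linear_E])
  then have "(\<lambda>m. star (E (e m)) - E (e m)) \<longlonglongrightarrow> 0"
    using E_diff[of 0 0] by (simp add: E_diff E_star)
  moreover have "(\<lambda>m. star (E (e m)) - E (e m)) \<longlonglongrightarrow> star w - w"
    by (intro tendsto_intros tendsto_star E_e_tendsto)
  ultimately have "star w - w = 0"
    by (rule LIMSEQ_unique[rotated])
  then show ?thesis by (simp add: selfadjoint_def)
qed

lemma selfadjoint_d: "selfadjoint d"
  by (rule selfadjoint_inverse[OF selfadjoint_w w_d d_w])

text \<open>The inverse \<open>w\<close> lies in \<open>P\<close> as a limit of values of
  \<open>E\<close>; so \<open>E d * w = E (d * w) = 1\<close>, and \<open>E d\<close> must be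
  \<open>d\<close>.\<close>

lemma d_in: "d \<in> P"
proof -
  have "E d * w = 1"
    using E_right[OF w_in, of d] E_id[OF cstar_subalgebra_one[OF P]] by (simp add: d_w)
  then have "E d = d"
    by (metis mult.assoc mult.left_neutral mult.right_neutral w_d)
  then show ?thesis using E_in[of d] by simp
qed

lemma defect_tendsto_zero: "(\<lambda>m. defect (e m) x) \<longlonglongrightarrow> 0"
proof -
  define K where "K e = e * d * star e - e * star e * star e * d - d * e * e * star e
    + d * e * E (e * star e) * star e * d" for e
  define D W where "D = const_seq d" and "W = const_seq w"
  have WD: "W * D = 1"
    by (simp add: W_def D_def const_seq_one w_d flip: const_seq_mult)
  have B: "Bseq (\<lambda>m. star (e m))" "Bseq (\<lambda>m. E (e m * star (e m)))" "Bseq (\<lambda>m. d)"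
    by (simp_all add: Bseq_star Bseq_E Bseq_times Bseq_e)
  have BK: "Bseq (\<lambda>m. K (e m))"
    unfolding K_def by (intro Bseq_plus Bseq_minus Bseq_times Bseq_e B)
  have "abs_seq_alg (\<lambda>m. K (e m)) = X * D * star X - X * star X * star X * D - D * X * X * star X
    + D * X * E_inf E (X * star X) * star X * D"
    unfolding K_def by (simp add: abs_seq_alg_plus abs_seq_alg_minus abs_seq_alg_times Bseq_plus Bseq_minus
        Bseq_times Bseq_e B abs_seq_alg_E abs_seq_alg_star abs_seq_alg_const D_def flip: X_e)
  \<comment> \<open>Once \<open>D\<close> and \<open>W\<close> are moved past \<open>X\<close> and
    \<open>W * D = 1\<close> is used, all four terms equal \<open>X * D\<close>, and their signs
    cancel.\<close>
  also have "\<dots> = 0"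
  proof -
    have "X * (X * z) = X * z" "D * (X * z) = X * (D * z)" "W * (X * z) = X * (W * z)"
      "D * X = X * D" for z
      using X_X const_X by (simp_all add: D_def W_def flip: mult.assoc)
    then show ?thesis
      by (simp add: star_X X_X E_X mult.assoc WD flip: W_def)
  qed
  finally have "abs_seq_alg (\<lambda>m. K (e m)) = abs_seq_alg (\<lambda>_. 0)"
    by (simp add: zero_seq_alg_def)
  then have K: "(\<lambda>m. K (e m)) \<longlonglongrightarrow> 0"
    using BK by (subst (asm) abs_seq_alg_eq_iff) simp_all
  \<comment> \<open>This value satisfies \<open>c * (norm x)\<^sup>2 \<le> 1\<close> and is positive
    even when \<open>x = 0\<close>.\<close>
  define c where "c = 1 / ((norm x)\<^sup>2 + 1)"
  have pos: "(norm x)\<^sup>2 + 1 > 0" by (simp add: add_nonneg_pos)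
  have "(\<lambda>m. c * (norm (defect (e m) x))\<^sup>2) \<longlonglongrightarrow> 0"
  proof (rule Lim_null_comparison)
    show "(\<lambda>m. norm (K (e m))) \<longlonglongrightarrow> 0"
      using K by (rule tendsto_norm_zero)
    show "\<forall>\<^sub>F m in sequentially. norm (c * (norm (defect (e m) x))\<^sup>2) \<le> norm (K (e m))"
      using defect_bound[of c x] pos selfadjoint_d
      by (intro always_eventually) (simp add: c_def K_def)
  qed
  then have "(\<lambda>m. (norm (defect (e m) x))\<^sup>2) \<longlonglongrightarrow> 0"
    using pos tendsto_mult_left_iff[of c _ 0] by (simp add: c_def)
  then have "(\<lambda>m. norm (defect (e m) x)) \<longlonglongrightarrow> 0"
    by simp
  then show ?thesis
    by (rule tendsto_norm_zero_cancel)
qed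

text \<open>Each term lies in \<open>P\<close>, but multiplicativity holds only for the class of the
  whole sequence.\<close>

definition approx_hom :: "'a \<Rightarrow> nat \<Rightarrow> 'a"
  where "approx_hom a m = d * E (e m * a)"

definition limit_hom :: "'a \<Rightarrow> 'a seq_alg"
  where "limit_hom a = abs_seq_alg (approx_hom a)"

lemma approx_hom_in: "approx_hom a m \<in> P"
  unfolding approx_hom_def by (intro cstar_subalgebra_mult P d_in E_in)

lemma Bseq_approx_hom: "Bseq (approx_hom a)"
  unfolding approx_hom_def by (intro Bseq_times Bseq_E Bseq_e) auto

lemma limit_hom: "limit_hom a = const_seq d * E_inf E (X * const_seq a)"
  unfolding limit_hom_def approx_hom_def
  by (simp add: abs_seq_alg_times abs_seq_alg_E abs_seq_alg_const Bseq_E Bseq_times Bseq_e flip: X_e)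

text \<open>This is the vanishing of the defect, read in the quotient; centrality of
  \<open>d\<close> brings it into this form.\<close>

lemma X_const: "X * const_seq a = X * limit_hom a"
proof -
  have "(\<lambda>m. e m * a - e m * approx_hom a m) = (\<lambda>m. defect (e m) a)"
    by (simp add: approx_hom_def defect_def d_central mult.assoc)
  then have "abs_seq_alg (\<lambda>m. e m * a) = abs_seq_alg (\<lambda>m. e m * approx_hom a m)"
    using defect_tendsto_zero[of a]
    by (subst abs_seq_alg_eq_iff) (simp_all add: Bseq_times Bseq_e Bseq_approx_hom)
  then show ?thesis
    by (simp add: limit_hom_def abs_seq_alg_times Bseq_e Bseq_approx_hom abs_seq_alg_const flip: X_e)
qed

text \<open>The second factor has terms in \<open>P\<close> and moves inside \<open>E\<close>. There
  \<open>const_seq a\<close> passes \<open>X\<close>, and \<open>X_const\<close> replaces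
  \<open>X * limit_hom b\<close> by \<open>X * const_seq b\<close>.\<close>

lemma limit_hom_mult: "limit_hom a * limit_hom b = limit_hom (a * b)"
proof -
  have "limit_hom a * limit_hom b = abs_seq_alg (\<lambda>m. d * E (e m * a * approx_hom b m))"
    unfolding limit_hom_def abs_seq_alg_times[OF Bseq_approx_hom Bseq_approx_hom, symmetric]
      E_right[OF approx_hom_in] mult.assoc[of d, symmetric] approx_hom_def[of a] ..
  also have "\<dots> = const_seq d * E_inf E (X * const_seq a * limit_hom b)"
    by (simp add: limit_hom_def abs_seq_alg_times abs_seq_alg_E abs_seq_alg_const Bseq_E Bseq_times
        Bseq_approx_hom Bseq_e flip: X_e)
  also have "X * const_seq a * limit_hom b = const_seq a * (X * limit_hom b)"
    by (simp add: mult.assoc flip: const_X)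
  also have "\<dots> = X * const_seq (a * b)"
    by (simp add: const_X const_seq_mult flip: X_const mult.assoc)
  also have "const_seq d * E_inf E \<dots> = limit_hom (a * b)"
    by (simp add: limit_hom)
  finally show ?thesis .
qed

lemma limit_hom_one: "limit_hom 1 = 1"
  by (simp add: limit_hom const_seq_one E_X d_w flip: const_seq_mult)

lemma star_limit_hom: "star (limit_hom a) = limit_hom (star a)"
proof -
  have "star (limit_hom a) = abs_seq_alg (\<lambda>m. d * E (star a * star (e m)))"
    using selfadjoint_d unfolding limit_hom_def abs_seq_alg_star[OF Bseq_approx_hom, symmetric]
    by (simp add: approx_hom_def star_mult d_central selfadjoint_def flip: E_star)
  also have "\<dots> = const_seq d * E_inf E (const_seq (star a) * star X)"
    by (simp add: abs_seq_alg_times abs_seq_alg_E abs_seq_alg_const abs_seq_alg_star Bseq_star Bseq_E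
        Bseq_times Bseq_e flip: X_e)
  finally show ?thesis
    by (simp add: star_X const_X limit_hom)
qed

section \<open>Transfer of real rank zero from the algebra to \<open>P\<close>\<close>

theorem real_rank_zero_if_rohlin:
  assumes "real_rank_zero (UNIV :: 'a set)"
  shows "real_rank_zero P"
  unfolding real_rank_zero_def
proof (rule subsetI, unfold closure_approachable, intro allI impI)
  fix p and \<epsilon> :: real
  assume "p \<in> {x \<in> P. selfadjoint x}" and \<epsilon>: "0 < \<epsilon>"
  then have p: "p \<in> P" "selfadjoint p" by auto
  obtain M where M: "\<And>m. norm (e m) \<le> M"
    using Bseq_e unfolding Bseq_bound by blast
  have "0 \<le> M"
    using norm_ge_zero M[of 0] by (rule order_trans)
  \<comment> \<open>\<open>L\<close> bounds every map \<open>b \<mapsto> approx_hom b m\<close> in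
    norm. In the tolerance for \<open>a\<close>, the factor 2 leaves half of
    \<open>\<epsilon>\<close> for the error at \<open>p\<close>, and \<open>L + 1\<close> avoids
    division by 0.\<close>
  define L where "L = norm d * M"
  have "0 \<le> L"
    using \<open>0 \<le> M\<close> by (simp add: L_def)
  obtain a where a: "selfadjoint a" "invertible_in UNIV a" "norm (a - p) < \<epsilon> / (2 * (L + 1))"
  proof -
    have "p \<in> closure {x \<in> UNIV. selfadjoint x \<and> invertible_in UNIV x}"
      using assms p(2) unfolding real_rank_zero_def by auto
    moreover have "0 < \<epsilon> / (2 * (L + 1))"
      using \<epsilon> \<open>0 \<le> L\<close> by simp
    ultimately show thesis
      unfolding closure_approachable dist_norm using that by blast
  qed
  obtain a' where a': "a * a' = 1" "a' * a = 1"
    using a(2) by (auto simp: invertible_in_def)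
  \<comment> \<open>The terms \<open>approx_hom a m\<close> are self-adjoint only in the limit.
    Their real parts are exactly self-adjoint and represent the same class.\<close>
  define h where "h m = (1/2) *\<^sub>R (approx_hom a m + star (approx_hom a m))" for m
  have h_in: "h m \<in> P" for m
    unfolding h_def by (intro cstar_subalgebra_scaleR cstar_subalgebra_add cstar_subalgebra_star P approx_hom_in)
  have h_sa: "selfadjoint (h m)" for m
    by (simp add: h_def selfadjoint_def star_scaleR star_add star_star add.commute)
  have Bh: "Bseq h"
  proof -
    have "Bseq (\<lambda>m. (1/2) *\<^sub>R (1 :: 'a) * (approx_hom a m + star (approx_hom a m)))"
      by (intro Bseq_times Bseq_plus Bseq_star Bseq_approx_hom) auto
    then show ?thesis by (simp add: h_def[abs_def])
  qed
  have "(\<lambda>m. star (approx_hom a m) - approx_hom a m) \<longlonglongrightarrow> 0"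
    using star_limit_hom[of a] a(1)
    by (subst abs_seq_alg_eq_iff[symmetric])
      (simp_all add: Bseq_star Bseq_approx_hom abs_seq_alg_star selfadjoint_def flip: limit_hom_def)
  then have "(\<lambda>m. (1/2) *\<^sub>R (star (approx_hom a m) - approx_hom a m)) \<longlonglongrightarrow> (1/2) *\<^sub>R 0"
    by (intro tendsto_intros)
  moreover have "h m - approx_hom a m = (1/2) *\<^sub>R (star (approx_hom a m) - approx_hom a m)" for m
    using scaleR_left.add[of "1/2" "1/2" "approx_hom a m"] by (simp add: h_def algebra_simps)
  ultimately have "abs_seq_alg h = limit_hom a"
    unfolding limit_hom_def by (subst abs_seq_alg_eq_iff) (simp_all add: Bh Bseq_approx_hom)
  then have "abs_seq_alg (\<lambda>m. h m * approx_hom a' m) = abs_seq_alg (\<lambda>_. 1)"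
    "abs_seq_alg (\<lambda>m. approx_hom a' m * h m) = abs_seq_alg (\<lambda>_. 1)"
    by (simp_all add: abs_seq_alg_times Bh Bseq_approx_hom limit_hom_mult a' limit_hom_one
        abs_seq_alg_const const_seq_one flip: limit_hom_def)
  then have "(\<lambda>m. h m * approx_hom a' m) \<longlonglongrightarrow> 1" "(\<lambda>m. approx_hom a' m * h m) \<longlonglongrightarrow> 1"
    by (simp_all add: abs_seq_alg_eq_iff Bseq_times Bh Bseq_approx_hom LIM_zero_iff)
  then have inv: "\<forall>\<^sub>F m in sequentially. invertible_in P (h m)"
    by (intro tendsto_inverse_imp_invertible_in[OF P h_in approx_hom_in])
  \<comment> \<open>On \<open>P\<close> the maps converge to the identity, because
    \<open>E (e m)\<close> tends to the inverse of \<open>d\<close>.\<close>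
  have "(\<lambda>m. d * E (e m) * p) \<longlonglongrightarrow> d * w * p"
    by (intro tendsto_intros E_e_tendsto)
  then have "\<forall>\<^sub>F m in sequentially. norm (d * E (e m) * p - p) < \<epsilon> / 2"
    using tendstoD[of _ p sequentially "\<epsilon> / 2"] \<epsilon> by (simp add: d_w dist_norm)
  with inv have "\<forall>\<^sub>F m in sequentially. invertible_in P (h m) \<and> norm (d * E (e m) * p - p) < \<epsilon> / 2"
    by (rule eventually_conj)
  then obtain m where m: "invertible_in P (h m)" "norm (d * E (e m) * p - p) < \<epsilon> / 2"
    using eventually_happens'[OF sequentially_bot] by blast
  have "norm (h m - p) < \<epsilon>"
  proof -
    have "approx_hom a m - p = d * E (e m * (a - p)) + (d * E (e m) * p - p)"
      using p(1) by (simp add: approx_hom_def algebra_simps E_diff E_right)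
    moreover have "norm (d * E (e m * (a - p))) \<le> norm d * (M * norm (a - p))"
      by (intro order_trans[OF norm_mult_ineq] mult_left_mono order_trans[OF norm_E] mult_right_mono M) auto
    moreover have "norm d * (M * norm (a - p)) \<le> \<epsilon> / 2"
    proof -
      have "L * norm (a - p) \<le> (L + 1) * (\<epsilon> / (2 * (L + 1)))"
        using a(3) \<open>0 \<le> L\<close> by (intro mult_mono) auto
      also have "\<dots> = \<epsilon> / 2"
        using \<open>0 \<le> L\<close> by (simp add: field_simps)
      finally show ?thesis by (simp add: L_def mult.assoc)
    qed
    moreover have "norm (approx_hom a m - p) \<le> norm (d * E (e m * (a - p))) + norm (d * E (e m) * p - p)"
      unfolding calculation(1) by (rule norm_triangle_ineq)
    ultimately have 1: "norm (approx_hom a m - p) < \<epsilon>"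
      using m(2) by linarith
    \<comment> \<open>Since \<open>p\<close> is self-adjoint, taking real parts does not increase
      the distance to it.\<close>
    have "h m - p = (1/2) *\<^sub>R ((approx_hom a m - p) + star (approx_hom a m - p))"
      using p(2) scaleR_left.add[of "1/2" "1/2" p] by (simp add: h_def star_diff selfadjoint_def algebra_simps)
    then have "norm (h m - p) \<le> norm (approx_hom a m - p)"
      using norm_triangle_ineq[of "approx_hom a m - p" "star (approx_hom a m - p)"] by (simp add: norm_star)
    with 1 show ?thesis by simp
  qed
  with m h_in h_sa show "\<exists>y\<in>{x \<in> P. selfadjoint x \<and> invertible_in P x}. dist y p < \<epsilon>"
    by (auto simp: dist_norm)
qed

end

theorem theorem5p10:
  fixes P :: "'a::cstar_algebra set"
  assumes "cstar_subalgebra P"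
    and "rohlin_inclusion P"
    and "real_rank_zero (UNIV :: 'a set)"
  shows "real_rank_zero P"
proof -
  obtain E where exp: "conditional_expectation E P" "finite_index E" "rohlin_expectation E"
    using assms(2) by (auto simp: rohlin_inclusion_def)
  obtain n u v where quasi: "quasi_basis E n u v"
    using exp(2) by (auto simp: finite_index_def)
  interpret finite_index_expectation E P n u v
    using assms(1) exp(1) quasi by unfold_locales
  obtain X w where X: "X \<in> central_seq_alg" "projection X" "w * Index E = 1" "Index E * w = 1"
      "E_inf E X = const_seq w"
    using exp(3) by (auto simp: rohlin_expectation_def)
  obtain e where e: "Bseq e" "X = abs_seq_alg e"
    by (rule seq_alg_representative)
  interpret rohlin E P n u v X w e
    using X e by unfold_locales (simp_all add: d_def Index_eq[OF quasi])
  show ?thesis using assms(3) by (rule real_rank_zero_if_rohlin)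
qed

end
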